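(* Let $X$ be a Köthe function space on a $\sigma$-finite measure space $(\Omega,\mu)$ with Fatou norm, let $K$ be a locally compact Hausdorff space, and let $\varepsilon\ge 0$. Then any $\varepsilon$-band preserving linear map $T:C_0(K,X)\to C_0(K,X)$ is automatically continuous.
   Context: A Köthe function space on a $\sigma$-finite measure space $(\Omega,\Sigma,\mu)$ is a Banach space $X$ consisting of equivalence classes, modulo equality almost everywhere, of locally integrable functions on $\Omega$ such that: (i) if $|f(\omega)|\le|g(\omega)|$ a.e. on $\Omega$ with $f$ $\Sigma$-measurable and $g\in X$, then $f\in X$ and $\|f\|\le\|g\|$; (ii) if $S\in\Sigma$ and $\mu(S)\in(0,\infty)$, then $\chi_S\in X$. It is a Banach lattice under the a.e. pointwise order. A Banach lattice $X$ has Fatou norm if there is a constant $\mathfrak{f}$ such that for any non-negative increasing net $(x_i)\subset X$ with $\sup_i\|x_i\|<\infty$ and such that $\bigvee_i x_i$ exists in $X$, one has $\|\bigvee_i x_i\|\le\mathfrak{f}\sup_i\|x_i\|$. $C_0(K,X)$ is the space of continuous functions $f:K\to X$ such that for every $\delta>0$ there is a compact set $A\subset K$ with $\|f(t)\|<\delta$ for $t\notin A$; with the norm $\|f\|=\sup_{t\in K}\|f(t)\|_X$ and the pointwise order it is a Banach lattice. A (not necessarily bounded) linear map $T:Z\to Z$ on a Banach lattice $Z$ is $\varepsilon$-band preserving ($\varepsilon$-BP) if for every $x\in Z$, $\sup\{\||Tx|\wedge y\| : y\ge 0,\ y\perp x\}\le\varepsilon\|x\|$. *)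

theory Defs
  imports
    "HOL-Analysis.Analysis"
    "HOL-Library.Lattice_Algebras"
    "HOL-Library.Lub_Glb"
begin

section \<open>Banach lattices\<close>

class banach_lattice = banach + ordered_real_vector + lattice_ab_group_add_abs +
  assumes norm_mono_abs: "\<bar>x\<bar> \<le> \<bar>y\<bar> \<Longrightarrow> norm x \<le> norm y"

lemma norm_abs_lattice: "norm \<bar>x\<bar> = norm (x :: 'a :: banach_lattice)"
  by (intro antisym norm_mono_abs) simp_all

lemma norm_sup_diff_le:
  fixes a b c d :: "'a :: banach_lattice"
  shows "norm (sup a b - sup c d) \<le> norm (a - c) + norm (b - d)"
proof -
  have le: "sup p q \<le> sup r s + (\<bar>p - r\<bar> + \<bar>q - s\<bar>)" for p q r s :: 'a
  proof (rule sup_least)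
    have "p = r + (p - r)" by simp
    also have "\<dots> \<le> sup r s + (\<bar>p - r\<bar> + \<bar>q - s\<bar>)"
      by (intro add_mono sup_ge1 add_increasing2) (simp_all add: abs_ge_self)
    finally show "p \<le> sup r s + (\<bar>p - r\<bar> + \<bar>q - s\<bar>)" .
    have "q = s + (q - s)" by simp
    also have "\<dots> \<le> sup r s + (\<bar>p - r\<bar> + \<bar>q - s\<bar>)"
      by (intro add_mono sup_ge2 add_increasing) (simp_all add: abs_ge_self)
    finally show "q \<le> sup r s + (\<bar>p - r\<bar> + \<bar>q - s\<bar>)" .
  qed
  let ?u = "\<bar>a - c\<bar> + \<bar>b - d\<bar>"
  have "\<bar>sup a b - sup c d\<bar> \<le> ?u"
  proof (rule abs_leI)
    show "sup a b - sup c d \<le> ?u"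
      using le[of a b c d] by (metis add.commute diff_le_eq)
    show "- (sup a b - sup c d) \<le> ?u"
      using le[of c d a b]
      by (metis abs_minus_commute add.commute diff_le_eq minus_diff_eq)
  qed
  then have "\<bar>sup a b - sup c d\<bar> \<le> \<bar>?u\<bar>"
    using abs_ge_self order_trans by blast
  then have "norm (sup a b - sup c d) \<le> norm ?u"
    by (rule norm_mono_abs)
  also have "\<dots> \<le> norm (a - c) + norm (b - d)"
    using norm_triangle_ineq[of "\<bar>a - c\<bar>" "\<bar>b - d\<bar>"] by (simp add: norm_abs_lattice)
  finally show ?thesis .
qed

lemma norm_sup_le: "norm (sup a b) \<le> norm a + norm (b :: 'a :: banach_lattice)"
  using norm_sup_diff_le[of a b 0 0] by simp

lemma continuous_on_sup_banach_lattice: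
  fixes f g :: "'k :: topological_space \<Rightarrow> 'a :: banach_lattice"
  assumes "continuous_on S f" "continuous_on S g"
  shows "continuous_on S (\<lambda>t. sup (f t) (g t))"
  unfolding continuous_on_def
proof
  fix t assume t: "t \<in> S"
  have "((\<lambda>s. norm (f s - f t) + norm (g s - g t)) \<longlongrightarrow> 0) (at t within S)"
    using assms t unfolding continuous_on_def
    by (intro tendsto_add_zero tendsto_norm_zero) (auto simp: LIM_zero_iff)
  then have "((\<lambda>s. sup (f s) (g s) - sup (f t) (g t)) \<longlongrightarrow> 0) (at t within S)"
    by (rule Lim_null_comparison[rotated]) (intro always_eventually allI norm_sup_diff_le)
  then show "((\<lambda>s. sup (f s) (g s)) \<longlongrightarrow> sup (f t) (g t)) (at t within S)"
    by (rule LIM_zero_cancel)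
qed

lemma norm_inf_le: "norm (inf a b) \<le> norm a + norm (b :: 'a :: banach_lattice)"
  using norm_sup_le[of "- a" "- b"]
  unfolding inf_eq_neg_sup[of a b] norm_minus_cancel .

lemma continuous_on_inf_banach_lattice:
  fixes f g :: "'k :: topological_space \<Rightarrow> 'a :: banach_lattice"
  assumes "continuous_on S f" "continuous_on S g"
  shows "continuous_on S (\<lambda>t. inf (f t) (g t))"
proof -
  have "continuous_on S (\<lambda>t. - sup (- f t) (- g t))"
    using assms by (intro continuous_on_minus continuous_on_sup_banach_lattice)
  then show ?thesis by (simp only: neg_sup_eq_inf minus_minus)
qed

definition disjoint_elems :: "'z :: banach_lattice \<Rightarrow> 'z \<Rightarrow> bool"
  where "disjoint_elems x y \<longleftrightarrow> inf \<bar>x\<bar> \<bar>y\<bar> = 0"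

text \<open>The supremum below is over a nonempty set (take \<open>y = 0\<close>) that is bounded above by
  \<open>norm (T x)\<close>, so it is a genuine real supremum.\<close>

definition eps_band_preserving :: "real \<Rightarrow> ('z :: banach_lattice \<Rightarrow> 'z) \<Rightarrow> bool"
  where "eps_band_preserving \<epsilon> T \<longleftrightarrow>
    (\<forall>x. (SUP y\<in>{y. 0 \<le> y \<and> disjoint_elems y x}. norm (inf \<bar>T x\<bar> y)) \<le> \<epsilon> * norm x)"

lemma bdd_above_band_preserving:
  fixes T :: "'z :: banach_lattice \<Rightarrow> 'z"
  shows "bdd_above ((\<lambda>y. norm (inf \<bar>T x\<bar> y)) ` {y. 0 \<le> y \<and> disjoint_elems y x})"
  by (rule bdd_aboveI2[where M = "norm (T x)"]) (auto intro!: norm_mono_abs simp: abs_of_nonneg)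

definition increasing_net ::
    "'i set \<Rightarrow> ('i \<Rightarrow> 'i \<Rightarrow> bool) \<Rightarrow> ('i \<Rightarrow> 'a :: order) \<Rightarrow> bool"
  where "increasing_net I r x \<longleftrightarrow>
    I \<noteq> {} \<and> (\<forall>i\<in>I. r i i) \<and>
    (\<forall>i\<in>I. \<forall>j\<in>I. \<forall>k\<in>I. r i j \<longrightarrow> r j k \<longrightarrow> r i k) \<and>
    (\<forall>i\<in>I. \<forall>j\<in>I. \<exists>k\<in>I. r i k \<and> r j k) \<and>
    (\<forall>i\<in>I. \<forall>j\<in>I. r i j \<longrightarrow> x i \<le> x j)"

text \<open>A definition cannot quantify over index types; indexing by subsets of \<open>'a\<close> loses nothing,
  because an increasing net may be replaced by its range indexed by itself. The lemma
  \<open>fatou_norm_net\<close> recovers the property for arbitrary index types.\<close>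

definition fatou_norm :: "'a :: banach_lattice itself \<Rightarrow> bool"
  where "fatou_norm _ \<longleftrightarrow>
    (\<exists>C. \<forall>(I :: 'a set) r (x :: 'a \<Rightarrow> 'a) s.
      increasing_net I r x \<longrightarrow> (\<forall>i\<in>I. 0 \<le> x i) \<longrightarrow> bdd_above ((\<lambda>i. norm (x i)) ` I) \<longrightarrow>
      isLub UNIV (x ` I) s \<longrightarrow> norm s \<le> C * (SUP i\<in>I. norm (x i)))"

lemma fatou_norm_net:
  assumes "fatou_norm TYPE('a :: banach_lattice)"
  shows "\<exists>C. \<forall>(I :: 'i set) r (x :: 'i \<Rightarrow> 'a) s.
      increasing_net I r x \<longrightarrow> (\<forall>i\<in>I. 0 \<le> x i) \<longrightarrow> bdd_above ((\<lambda>i. norm (x i)) ` I) \<longrightarrow>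
      isLub UNIV (x ` I) s \<longrightarrow> norm s \<le> C * (SUP i\<in>I. norm (x i))"
proof -
  obtain C where C: "\<forall>(I :: 'a set) r (x :: 'a \<Rightarrow> 'a) s.
      increasing_net I r x \<longrightarrow> (\<forall>i\<in>I. 0 \<le> x i) \<longrightarrow> bdd_above ((\<lambda>i. norm (x i)) ` I) \<longrightarrow>
      isLub UNIV (x ` I) s \<longrightarrow> norm s \<le> C * (SUP i\<in>I. norm (x i))"
    using assms unfolding fatou_norm_def by (elim exE)
  show ?thesis
  proof (intro exI[of _ C] allI impI)
    fix I :: "'i set" and r and x :: "'i \<Rightarrow> 'a" and s
    assume net: "increasing_net I r x" and nonneg: "\<forall>i\<in>I. 0 \<le> x i"
      and bdd: "bdd_above ((\<lambda>i. norm (x i)) ` I)" and lub: "isLub UNIV (x ` I) s"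
    have ne: "I \<noteq> {}" using net unfolding increasing_net_def by (elim conjE)
    have dir: "\<forall>i\<in>I. \<forall>j\<in>I. \<exists>k\<in>I. r i k \<and> r j k"
      using net unfolding increasing_net_def by (elim conjE)
    have mono: "\<forall>i\<in>I. \<forall>j\<in>I. r i j \<longrightarrow> x i \<le> x j"
      using net unfolding increasing_net_def by (elim conjE)
    have dir': "\<exists>c\<in>x ` I. a \<le> c \<and> b \<le> c" if ab: "a \<in> x ` I" "b \<in> x ` I" for a b
    proof -
      obtain i j where ij: "i \<in> I" "j \<in> I" "a = x i" "b = x j"
        using ab by blast
      obtain k where "k \<in> I" "r i k" "r j k"
        using dir ij(1,2) by blast
      with mono ij show ?thesis by (intro bexI[of _ "x k"]) simp_all
    qed
    have 1: "increasing_net (x ` I) (\<le>) (\<lambda>a. a)"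
      unfolding increasing_net_def
    proof (intro conjI ballI impI)
      show "x ` I \<noteq> {}" using ne by simp
      show "a \<le> c" if "a \<le> b" "b \<le> c" for a b c :: 'a using that by (rule order_trans)
    qed (rule order_refl, rule dir', assumption+)
    have 2: "\<forall>a\<in>x ` I. 0 \<le> a" using nonneg by blast
    have 3: "bdd_above (norm ` x ` I)" using bdd by (simp only: image_image)
    have 4: "isLub UNIV ((\<lambda>a. a) ` x ` I) s" using lub by (simp only: image_ident)
    have "norm s \<le> C * (SUP a\<in>x ` I. norm a)"
      using C[THEN spec, THEN spec, THEN spec, THEN spec, THEN mp, OF 1,
        THEN mp, OF 2, THEN mp, OF 3, THEN mp, OF 4] .
    then show "norm s \<le> C * (SUP i\<in>I. norm (x i))"
      by (simp only: image_image)
  qed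
qed


section \<open>Koethe function spaces\<close>

text \<open>The type \<open>'x\<close> is the space, and \<open>rep x\<close> is a measurable representative of the equivalence
  class \<open>x\<close> modulo equality almost everywhere. Membership of a measurable function \<open>f\<close> in the
  space is expressed as \<open>\<exists>x. AE w in M. rep x w = f w\<close>. Locally integrable means integrable on
  every measurable set of finite measure.\<close>

locale koethe_function_space = sigma_finite_measure M
  for M :: "'w measure" +
  fixes rep :: "'x :: banach_lattice \<Rightarrow> 'w \<Rightarrow> real"
  assumes rep_measurable: "rep x \<in> borel_measurable M"
    and rep_locally_integrable:
      "S \<in> sets M \<Longrightarrow> emeasure M S < \<infinity> \<Longrightarrow> set_integrable M S (rep x)"
    and rep_inject: "(AE w in M. rep x w = rep y w) \<Longrightarrow> x = y"
    and rep_add: "AE w in M. rep (x + y) w = rep x w + rep y w"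
    and rep_scaleR: "AE w in M. rep (c *\<^sub>R x) w = c * rep x w"
    and rep_le_iff: "x \<le> y \<longleftrightarrow> (AE w in M. rep x w \<le> rep y w)"
    and rep_ideal:
      "f \<in> borel_measurable M \<Longrightarrow> (AE w in M. \<bar>f w\<bar> \<le> \<bar>rep g w\<bar>) \<Longrightarrow>
        \<exists>x. (AE w in M. rep x w = f w) \<and> norm x \<le> norm g"
    and rep_indicator:
      "S \<in> sets M \<Longrightarrow> 0 < emeasure M S \<Longrightarrow> emeasure M S < \<infinity> \<Longrightarrow>
        \<exists>x. AE w in M. rep x w = indicator S w"


section \<open>The Banach lattice of continuous functions vanishing at infinity\<close>

definition vanishes_at_infinity ::
    "('k :: topological_space \<Rightarrow> 'x :: real_normed_vector) \<Rightarrow> bool"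
  where "vanishes_at_infinity f \<longleftrightarrow> (\<forall>\<delta>>0. \<exists>A. compact A \<and> (\<forall>t. t \<notin> A \<longrightarrow> norm (f t) < \<delta>))"

lemma vanishes_at_infinity_le_add:
  assumes "vanishes_at_infinity f" "vanishes_at_infinity g"
    and le: "\<And>t. norm (h t) \<le> norm (f t) + norm (g t)"
  shows "vanishes_at_infinity h"
  unfolding vanishes_at_infinity_def
proof (intro allI impI)
  fix \<delta> :: real assume "\<delta> > 0"
  then have "\<delta> / 2 > 0" by simp
  with assms(1,2) obtain A B where "compact A" "compact B"
    and "\<And>t. t \<notin> A \<Longrightarrow> norm (f t) < \<delta> / 2" "\<And>t. t \<notin> B \<Longrightarrow> norm (g t) < \<delta> / 2"
    unfolding vanishes_at_infinity_def by meson
  then have "compact (A \<union> B)" "\<forall>t. t \<notin> A \<union> B \<longrightarrow> norm (h t) < \<delta>"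
    using le by (auto simp: compact_Un) (smt (verit) field_sum_of_halves)
  then show "\<exists>A. compact A \<and> (\<forall>t. t \<notin> A \<longrightarrow> norm (h t) < \<delta>)" by blast
qed

lemma vanishes_at_infinity_zero: "vanishes_at_infinity (\<lambda>t. 0)"
  unfolding vanishes_at_infinity_def using compact_empty by auto

lemma vanishes_at_infinity_scaleR:
  assumes "vanishes_at_infinity f"
  shows "vanishes_at_infinity (\<lambda>t. c *\<^sub>R f t)"
proof (cases "c = 0")
  case True
  then show ?thesis by (simp add: vanishes_at_infinity_zero)
next
  case False
  show ?thesis unfolding vanishes_at_infinity_def
  proof (intro allI impI)
    fix \<delta> :: real assume "\<delta> > 0"
    with False have "\<delta> / \<bar>c\<bar> > 0" by simp
    with assms obtain A where "compact A" "\<forall>t. t \<notin> A \<longrightarrow> norm (f t) < \<delta> / \<bar>c\<bar>"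
      unfolding vanishes_at_infinity_def by meson
    then show "\<exists>A. compact A \<and> (\<forall>t. t \<notin> A \<longrightarrow> norm (c *\<^sub>R f t) < \<delta>)"
      using False by (auto simp: field_simps)
  qed
qed

lemma vanishes_at_infinity_bounded:
  assumes "continuous_on UNIV f" "vanishes_at_infinity f"
  shows "bounded (range f)"
proof -
  obtain A where A: "compact A" "\<And>t. t \<notin> A \<Longrightarrow> norm (f t) < 1"
    using assms(2) unfolding vanishes_at_infinity_def by (meson zero_less_one)
  have "compact (f ` A)"
    using A(1) assms(1) by (meson compact_continuous_image continuous_on_subset subset_UNIV)
  then have "bounded (f ` A \<union> ball 0 1)"
    by (simp add: compact_imp_bounded)
  moreover have "range f \<subseteq> f ` A \<union> ball 0 1"
    using A(2) by (force simp: dist_norm)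
  ultimately show ?thesis by (rule bounded_subset)
qed

typedef (overloaded) ('k, 'x) c0 =
  "{f :: 'k :: topological_space \<Rightarrow> 'x :: real_normed_vector.
     continuous_on UNIV f \<and> vanishes_at_infinity f}"
  morphisms apply_c0 Abs_c0
  by (rule exI[of _ "\<lambda>t. 0"]) (simp add: vanishes_at_infinity_zero)

setup_lifting type_definition_c0

lemma c0_eqI: "(\<And>t. apply_c0 f t = apply_c0 g t) \<Longrightarrow> f = g"
  by transfer auto

lemma bounded_range_c0: "bounded (range (apply_c0 f))"
  by transfer (auto intro: vanishes_at_infinity_bounded)

instantiation c0 :: (topological_space, real_normed_vector) real_normed_vector
begin

lift_definition zero_c0 :: "('a, 'b) c0" is "\<lambda>t. 0"
  by (simp add: vanishes_at_infinity_zero)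

lift_definition plus_c0 :: "('a, 'b) c0 \<Rightarrow> ('a, 'b) c0 \<Rightarrow> ('a, 'b) c0"
  is "\<lambda>f g t. f t + g t"
  by (elim conjE, intro conjI, erule (1) continuous_on_add,
      erule (1) vanishes_at_infinity_le_add, rule norm_triangle_ineq)

lift_definition minus_c0 :: "('a, 'b) c0 \<Rightarrow> ('a, 'b) c0 \<Rightarrow> ('a, 'b) c0"
  is "\<lambda>f g t. f t - g t"
  by (elim conjE, intro conjI, erule (1) continuous_on_diff,
      erule (1) vanishes_at_infinity_le_add, rule norm_triangle_ineq4)

lift_definition uminus_c0 :: "('a, 'b) c0 \<Rightarrow> ('a, 'b) c0" is "\<lambda>f t. - f t"
  by (simp add: continuous_on_minus vanishes_at_infinity_def)

lift_definition scaleR_c0 :: "real \<Rightarrow> ('a, 'b) c0 \<Rightarrow> ('a, 'b) c0" is "\<lambda>c f t. c *\<^sub>R f t"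
  by (simp add: continuous_on_scaleR vanishes_at_infinity_scaleR)

lift_definition norm_c0 :: "('a, 'b) c0 \<Rightarrow> real" is "\<lambda>f. SUP t. norm (f t)" .

definition dist_c0 :: "('a, 'b) c0 \<Rightarrow> ('a, 'b) c0 \<Rightarrow> real"
  where "dist_c0 f g = norm (f - g)"

definition sgn_c0 :: "('a, 'b) c0 \<Rightarrow> ('a, 'b) c0"
  where "sgn_c0 f = inverse (norm f) *\<^sub>R f"

definition uniformity_c0 :: "(('a, 'b) c0 \<times> ('a, 'b) c0) filter"
  where "uniformity_c0 = (INF e\<in>{0 <..}. principal {(x, y). dist x y < e})"

definition open_c0 :: "('a, 'b) c0 set \<Rightarrow> bool"
  where "open_c0 S = (\<forall>x\<in>S. \<forall>\<^sub>F (x', y) in uniformity. x' = x \<longrightarrow> y \<in> S)"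

lemma norm_apply_c0_le: "norm (apply_c0 f t) \<le> norm (f :: ('a, 'b) c0)"
  unfolding norm_c0.rep_eq
  by (rule cSUP_upper) (use bounded_range_c0[of f] in
    \<open>auto simp: bounded_norm_comp bounded_imp_bdd_above\<close>)

lemma norm_c0_le: "(\<And>t. norm (apply_c0 f t) \<le> b) \<Longrightarrow> norm (f :: ('a, 'b) c0) \<le> b"
  unfolding norm_c0.rep_eq by (rule cSUP_least) auto

instance
proof
  fix f g h :: "('a, 'b) c0" and a b :: real
  show "f + g + h = f + (g + h)" "f + g = g + f" "0 + f = f" "- f + f = 0" "f - g = f + - g"
    "a *\<^sub>R (f + g) = a *\<^sub>R f + a *\<^sub>R g" "(a + b) *\<^sub>R f = a *\<^sub>R f + b *\<^sub>R f"
    "a *\<^sub>R b *\<^sub>R f = (a * b) *\<^sub>R f" "1 *\<^sub>R f = f"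
    by (transfer; simp add: algebra_simps)+
  show "dist f g = norm (f - g)" by (rule dist_c0_def)
  show "sgn f = inverse (norm f) *\<^sub>R f" by (rule sgn_c0_def)
  show "uniformity = (INF e\<in>{0 <..}. principal {(x, y :: ('a, 'b) c0). dist x y < e})"
    by (rule uniformity_c0_def)
  show "open U = (\<forall>x\<in>U. \<forall>\<^sub>F (x', y) in uniformity. x' = x \<longrightarrow> y \<in> U)"
    for U :: "('a, 'b) c0 set" by (rule open_c0_def)
  show "norm f = 0 \<longleftrightarrow> f = 0"
  proof
    assume "norm f = 0"
    then have "apply_c0 f t = 0" for t
      using norm_apply_c0_le[of f t] by simp
    then show "f = 0" by (intro c0_eqI) (simp add: zero_c0.rep_eq)
  qed (simp add: norm_c0.rep_eq zero_c0.rep_eq)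
  show "norm (f + g) \<le> norm f + norm g"
    by (rule norm_c0_le)
      (use norm_apply_c0_le[of f] norm_apply_c0_le[of g] in
        \<open>auto simp: plus_c0.rep_eq intro: norm_triangle_le add_mono\<close>)
  have le: "norm (a *\<^sub>R f) \<le> \<bar>a\<bar> * norm f" for a and f :: "('a, 'b) c0"
    by (rule norm_c0_le)
      (auto simp: scaleR_c0.rep_eq intro!: mult_left_mono norm_apply_c0_le)
  have id: "1 *\<^sub>R f = f" by transfer simp
  have assoc: "inverse a *\<^sub>R a *\<^sub>R f = (inverse a * a) *\<^sub>R f" by transfer simp
  show "norm (a *\<^sub>R f) = \<bar>a\<bar> * norm f"
  proof (cases "a = 0")
    case True
    have "0 *\<^sub>R f = 0" by transfer simp
    with True show ?thesis
      by (simp add: norm_c0.rep_eq zero_c0.rep_eq)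
  next
    case False
    then have "norm f \<le> \<bar>inverse a\<bar> * norm (a *\<^sub>R f)"
      using le[of "inverse a" "a *\<^sub>R f"] assoc id by simp
    then have "\<bar>a\<bar> * norm f \<le> norm (a *\<^sub>R f)"
      using False by (simp add: field_simps abs_inverse)
    with le show ?thesis by (intro antisym)
  qed
qed

end

lemma dist_apply_c0_le: "dist (apply_c0 f t) (apply_c0 g t) \<le> dist f g"
  using norm_apply_c0_le[of "f - g" t] by (simp add: dist_norm minus_c0.rep_eq)

instance c0 :: (topological_space, banach) banach
proof
  fix F :: "nat \<Rightarrow> ('a, 'b) c0"
  assume F: "Cauchy F"
  have "uniformly_Cauchy_on UNIV (\<lambda>n. apply_c0 (F n))"
  proof (rule uniformly_Cauchy_onI)
    fix e :: real assume "e > 0"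
    with F obtain N where N: "\<And>m n. m \<ge> N \<Longrightarrow> n \<ge> N \<Longrightarrow> dist (F m) (F n) < e"
      unfolding Cauchy_def by meson
    show "\<exists>N. \<forall>t\<in>UNIV. \<forall>m\<ge>N. \<forall>n\<ge>N. dist (apply_c0 (F m) t) (apply_c0 (F n) t) < e"
      by (intro exI[of _ N] ballI allI impI le_less_trans[OF dist_apply_c0_le N])
  qed
  then have "uniformly_convergent_on UNIV (\<lambda>n. apply_c0 (F n))"
    by (rule Cauchy_uniformly_convergent)
  then obtain g where g: "uniform_limit UNIV (\<lambda>n. apply_c0 (F n)) g sequentially"
    unfolding uniformly_convergent_on_def by (elim exE)
  have cont: "continuous_on UNIV g"
    by (rule uniform_limit_theorem[OF _ g])
      (use apply_c0 in \<open>auto intro!: always_eventually\<close>)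
  have van: "vanishes_at_infinity g"
    unfolding vanishes_at_infinity_def
  proof (intro allI impI)
    fix \<delta> :: real assume "\<delta> > 0"
    then have d: "\<delta> / 2 > 0" by simp
    obtain n where n: "\<And>t. dist (apply_c0 (F n) t) (g t) < \<delta> / 2"
      using g d unfolding uniform_limit_sequentially_iff by blast
    have "vanishes_at_infinity (apply_c0 (F n))"
      using apply_c0[of "F n"] by simp
    with d obtain A where A: "compact A" "\<And>t. t \<notin> A \<Longrightarrow> norm (apply_c0 (F n) t) < \<delta> / 2"
      unfolding vanishes_at_infinity_def by meson
    have "norm (g t) < \<delta>" if "t \<notin> A" for t
    proof -
      have "norm (g t) \<le> norm (apply_c0 (F n) t) + dist (apply_c0 (F n) t) (g t)"
        by (metis add.commute dist_commute dist_norm norm_triangle_sub)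
      with A(2)[OF that] n[of t] show ?thesis by linarith
    qed
    with A(1) show "\<exists>A. compact A \<and> (\<forall>t. t \<notin> A \<longrightarrow> norm (g t) < \<delta>)" by blast
  qed
  have G: "apply_c0 (Abs_c0 g) = g"
    using cont van by (simp add: Abs_c0_inverse)
  have "F \<longlonglongrightarrow> Abs_c0 g"
  proof (rule metric_LIMSEQ_I)
    fix e :: real assume "e > 0"
    then have "e / 2 > 0" by simp
    with g obtain N where N: "\<And>n t. n \<ge> N \<Longrightarrow> dist (apply_c0 (F n) t) (g t) < e / 2"
      unfolding uniform_limit_sequentially_iff by blast
    have "dist (F n) (Abs_c0 g) < e" if "n \<ge> N" for n
    proof -
      have "norm (F n - Abs_c0 g) \<le> e / 2"
        using N[OF that]
        by (intro norm_c0_le less_imp_le) (simp add: minus_c0.rep_eq G dist_norm)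
      with \<open>e > 0\<close> show ?thesis by (simp add: dist_norm)
    qed
    then show "\<exists>N. \<forall>n\<ge>N. dist (F n) (Abs_c0 g) < e" by blast
  qed
  then show "convergent F" by (auto simp: convergent_def)
qed

instantiation c0 :: (topological_space, banach_lattice) banach_lattice
begin

lift_definition less_eq_c0 :: "('a, 'b) c0 \<Rightarrow> ('a, 'b) c0 \<Rightarrow> bool" is "\<lambda>f g. \<forall>t. f t \<le> g t" .

definition less_c0 :: "('a, 'b) c0 \<Rightarrow> ('a, 'b) c0 \<Rightarrow> bool"
  where "less_c0 f g \<longleftrightarrow> f \<le> g \<and> \<not> g \<le> f"

lift_definition sup_c0 :: "('a, 'b) c0 \<Rightarrow> ('a, 'b) c0 \<Rightarrow> ('a, 'b) c0"
  is "\<lambda>f g t. sup (f t) (g t)"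
  by (elim conjE, intro conjI, erule (1) continuous_on_sup_banach_lattice,
      erule (1) vanishes_at_infinity_le_add, rule norm_sup_le)

lift_definition inf_c0 :: "('a, 'b) c0 \<Rightarrow> ('a, 'b) c0 \<Rightarrow> ('a, 'b) c0"
  is "\<lambda>f g t. inf (f t) (g t)"
  by (elim conjE, intro conjI, erule (1) continuous_on_inf_banach_lattice,
      erule (1) vanishes_at_infinity_le_add, rule norm_inf_le)

definition abs_c0 :: "('a, 'b) c0 \<Rightarrow> ('a, 'b) c0"
  where "abs_c0 f = sup f (- f)"

lemma apply_c0_abs: "apply_c0 \<bar>f :: ('a, 'b) c0\<bar> t = \<bar>apply_c0 f t\<bar>"
  by (simp add: abs_c0_def sup_c0.rep_eq uminus_c0.rep_eq abs_lattice)

instance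
proof
  fix f g h :: "('a, 'b) c0" and a b :: real
  show "f < g \<longleftrightarrow> f \<le> g \<and> \<not> g \<le> f" by (rule less_c0_def)
  show "f \<le> f" by transfer simp
  show "f \<le> g \<Longrightarrow> g \<le> h \<Longrightarrow> f \<le> h" unfolding less_eq_c0.rep_eq
    by (rule allI) (erule allE, erule allE, erule (1) order_trans)
  show "f \<le> g \<Longrightarrow> g \<le> f \<Longrightarrow> f = g" unfolding less_eq_c0.rep_eq
    by (intro c0_eqI antisym) (erule spec)+
  show "f \<le> g \<Longrightarrow> h + f \<le> h + g" by transfer simp
  show "f \<le> g \<Longrightarrow> 0 \<le> a \<Longrightarrow> a *\<^sub>R f \<le> a *\<^sub>R g" by transfer (simp add: scaleR_left_mono)
  show "a \<le> b \<Longrightarrow> 0 \<le> f \<Longrightarrow> a *\<^sub>R f \<le> b *\<^sub>R f" by transfer (simp add: scaleR_right_mono)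
  show "inf f g \<le> f" "inf f g \<le> g" "f \<le> sup f g" "g \<le> sup f g" by (transfer; simp)+
  show "f \<le> g \<Longrightarrow> f \<le> h \<Longrightarrow> f \<le> inf g h" by transfer simp
  show "g \<le> f \<Longrightarrow> h \<le> f \<Longrightarrow> sup g h \<le> f" by transfer simp
  show "\<bar>f\<bar> = sup f (- f)" by (rule abs_c0_def)
  assume le: "\<bar>f\<bar> \<le> \<bar>g\<bar>"
  show "norm f \<le> norm g"
  proof (rule norm_c0_le)
    fix t
    have "norm (apply_c0 f t) \<le> norm (apply_c0 g t)"
      using le by (intro norm_mono_abs) (simp add: less_eq_c0.rep_eq apply_c0_abs)
    also have "\<dots> \<le> norm g" by (rule norm_apply_c0_le)
    finally show "norm (apply_c0 f t) \<le> norm g" .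
  qed
qed

end

end

theory Submission
  imports Defs
begin

text \<open>By uniform boundedness it suffices that each point evaluation \<open>f \<mapsto> T f t\<close> is bounded.
  If \<open>f\<close> vanishes near \<open>t\<close> then \<open>norm (T f t) \<le> \<epsilon> * norm f\<close>, so up to an error of order \<open>\<epsilon>\<close> the value
  \<open>T f t\<close> depends only on the germ of \<open>f\<close> at \<open>t\<close>.

  If \<open>t\<close> is not isolated and evaluation at \<open>t\<close> is unbounded, continuity of \<open>T f\<close> moves large values
  to points \<open>s \<noteq> t\<close> close to \<open>t\<close>. Localising around such points yields small functions with pairwise
  disjoint supports and huge images, whose sum contradicts boundedness of its image.

  If \<open>t\<close> is isolated, \<open>T\<close> induces a linear map \<open>S\<close> on the Koethe space for which the off-diagonal
  blocks \<open>P\<^sub>A S P\<^sub>B\<close> (\<open>A \<inter> B = {}\<close>) have norm at most \<open>\<epsilon>\<close>. The same gliding hump, now over disjoint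
  measurable sets and combined with the Fatou property, shows that if \<open>S\<close> is unbounded, then so is
  \<open>P\<^sub>E S P\<^sub>E\<close> for some atom \<open>E\<close> of the measure. But \<open>P\<^sub>E\<close> has rank one.\<close>

section \<open>Evaluation at points of the locally compact space\<close>

text \<open>Baire category: the closed sets \<open>F n\<close> on which the whole family is bounded
  by \<open>n\<close> cover a complete space, so one of them contains a ball, and linearity carries
  the bound from the ball to the whole space.\<close>

lemma uniform_boundedness_principle:
  fixes L :: "'i \<Rightarrow> 'a :: banach \<Rightarrow> 'b :: real_normed_vector"
  assumes L: "\<And>i. bounded_linear (L i)"
    and bdd: "\<And>x. \<exists>B. \<forall>i. norm (L i x) \<le> B"
  shows "\<exists>C. \<forall>i x. norm (L i x) \<le> C * norm x"
proof -
  define F where "F n = {x. \<forall>i. norm (L i x) \<le> real n}" for n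
  have cont: "continuous_on UNIV (\<lambda>x. norm (L i x))" for i
    using linear_continuous_on[OF L] continuous_on_norm by blast
  have closed_F: "closed (F n)" for n
    unfolding F_def using cont by (intro closed_Collect_all closed_Collect_le) auto
  have UN_F: "\<Union> (range F) = UNIV"
  proof -
    have "\<exists>n. x \<in> F n" for x
    proof -
      obtain B where "\<forall>i. norm (L i x) \<le> B" using bdd by blast
      then have "x \<in> F (nat \<lceil>B\<rceil>)" unfolding F_def
        by (auto intro: order_trans[OF _ real_nat_ceiling_ge])
      then show ?thesis by blast
    qed
    then show ?thesis by blast
  qed
  have "\<exists>n. interior (F n) \<noteq> {}"
  proof (rule ccontr)
    assume "\<not> (\<exists>n. interior (F n) \<noteq> {})"
    then have "(euclidean interior_of \<Union> (range F)) = {}"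
      by (intro Baire_category_alt)
        (auto simp: closed_F completely_metrizable_space_euclidean)
    then show False by (simp add: UN_F)
  qed
  then obtain n a where "a \<in> interior (F n)" by blast
  then obtain e where e: "e > 0" "cball a e \<subseteq> F n"
    by (meson mem_interior_cball)
  \<comment> \<open>A vector \<open>y\<close> of norm \<open>e\<close> is the difference of the
    points \<open>a + y\<close> and \<open>a\<close> of \<open>F n\<close>, whence the factor 2;
    rescaling \<open>x\<close> to norm \<open>e\<close> gives the divisor.\<close>
  have "norm (L i x) \<le> (2 * real n / e) * norm x" for i x
  proof (cases "x = 0")
    case True
    then show ?thesis using L[of i] by (simp add: linear_simps)
  next
    case False
    interpret bounded_linear "L i" by (rule L)
    define y where "y = (e / norm x) *\<^sub>R x"
    have ny: "norm y = e" using False e(1) by (simp add: y_def)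
    have "a + y \<in> F n" "a \<in> F n" using e ny by (auto simp: dist_norm subset_iff)
    then have "norm (L i (a + y)) \<le> n" "norm (L i a) \<le> n" by (auto simp: F_def)
    then have "norm (L i (a + y) - L i a) \<le> 2 * real n"
      using norm_triangle_ineq4[of "L i (a + y)" "L i a"] by linarith
    then have "norm (L i y) \<le> 2 * real n" by (simp add: add)
    then show ?thesis using False e(1) by (simp add: y_def scaleR field_simps)
  qed
  then show ?thesis by blast
qed

section \<open>Cutoff functions and locality of \<open>T\<close> up to \<epsilon>\<close>

text \<open>Complete regularity separates only the point \<open>t\<close> from the complement of
  \<open>U\<close>. The bump has to be 1 on a whole neighbourhood, so that multiplication by it
  preserves germs at \<open>t\<close>.\<close>

lemma completely_regular_bump:
  fixes t :: "'k :: t2_space"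
  assumes "locally_compact_space (euclidean :: 'k topology)" "open U" "t \<in> U"
  obtains \<phi> :: "'k \<Rightarrow> real" and W where "continuous_on UNIV \<phi>" "\<And>s. 0 \<le> \<phi> s" "\<And>s. \<phi> s \<le> 1"
    "\<And>s. s \<notin> U \<Longrightarrow> \<phi> s = 0" "open W" "t \<in> W" "\<And>s. s \<in> W \<Longrightarrow> \<phi> s = 1"
proof -
  have "Hausdorff_space (euclidean :: 'k topology)"
    by (simp add: Hausdorff_space_def disjnt_def) (metis hausdorff)
  then have "completely_regular_space (euclidean :: 'k topology)"
    using assms(1) locally_compact_regular_imp_completely_regular_space by blast
  then obtain f :: "'k \<Rightarrow> real" where f: "continuous_on UNIV f" "f t = 0" "f ` (- U) \<subseteq> {1}"
    using assms(2,3) unfolding completely_regular_space_alt' Compl_eq_Diff_UNIV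
    by (simp only: open_openin[symmetric] topspace_euclidean continuous_map_iff_continuous2) blast
  \<comment> \<open>The affine map sends the value 1 of \<open>f\<close> to 0 and its values below
    1/2 to values above 1, which the truncation flattens to 1.\<close>
  define \<phi> where "\<phi> s = max 0 (min 1 (2 - 2 * f s))" for s
  show thesis
  proof (rule that[of \<phi> "{s. f s < 1/2}"])
    show "continuous_on UNIV \<phi>" unfolding \<phi>_def by (intro continuous_intros f)
    show "open {s. f s < 1/2}" by (intro open_Collect_less continuous_intros f)
    show "\<phi> s = 0" if "s \<notin> U" for s
    proof -
      have "f s = 1" using f(3) that by blast
      then show ?thesis by (simp add: \<phi>_def)
    qed
  qed (auto simp: \<phi>_def f(2))
qed

lemma c0_scale_bump:
  fixes f :: "('k :: topological_space, 'x :: real_normed_vector) c0"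
  assumes "continuous_on UNIV \<phi>" "\<And>s. 0 \<le> \<phi> s" "\<And>s. \<phi> s \<le> (1::real)"
  obtains g where "\<And>s. apply_c0 g s = \<phi> s *\<^sub>R apply_c0 f s"
proof -
  have f: "continuous_on UNIV (apply_c0 f)" "vanishes_at_infinity (apply_c0 f)"
    using apply_c0[of f] by auto
  have "norm (\<phi> s *\<^sub>R apply_c0 f s) \<le> norm (apply_c0 f s) + norm (0 :: 'x)" for s
    using mult_right_mono[OF assms(3), of "norm (apply_c0 f s)" s] assms(2)[of s] by simp
  then have "vanishes_at_infinity (\<lambda>s. \<phi> s *\<^sub>R apply_c0 f s)"
    by (rule vanishes_at_infinity_le_add[OF f(2) vanishes_at_infinity_zero])
  moreover have "continuous_on UNIV (\<lambda>s. \<phi> s *\<^sub>R apply_c0 f s)"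
    by (intro continuous_intros assms f)
  ultimately show thesis
    by (intro that[of "Abs_c0 (\<lambda>s. \<phi> s *\<^sub>R apply_c0 f s)"]) (simp add: Abs_c0_inverse)
qed

lemma bounded_linear_apply_c0:
  "bounded_linear (\<lambda>f :: ('k :: topological_space, 'x :: real_normed_vector) c0. apply_c0 f t)"
  by (rule bounded_linear_intro[where K = 1])
    (auto simp: plus_c0.rep_eq scaleR_c0.rep_eq norm_apply_c0_le)

lemma eps_band_preservingD:
  assumes "eps_band_preserving \<epsilon> T" "0 \<le> y" "disjoint_elems y x"
  shows "norm (inf \<bar>T x\<bar> y) \<le> \<epsilon> * norm x"
proof -
  have "norm (inf \<bar>T x\<bar> y) \<le> (SUP y\<in>{y. 0 \<le> y \<and> disjoint_elems y x}. norm (inf \<bar>T x\<bar> y))"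
    using assms(2,3) by (intro cSUP_upper bdd_above_band_preserving) auto
  also have "\<dots> \<le> \<epsilon> * norm x"
    using assms(1) unfolding eps_band_preserving_def by blast
  finally show ?thesis .
qed

text \<open>The hypothesis on \<open>T\<close> is tested with a cutoff \<open>y\<close> of
  \<open>\<bar>T f\<bar>\<close> itself: \<open>y\<close> vanishes off \<open>U\<close>, hence is
  disjoint from \<open>f\<close>, and it equals \<open>\<bar>T f\<bar>\<close> at \<open>t\<close>,
  so the infimum loses nothing there.\<close>

lemma eps_band_preserving_local:
  fixes T :: "('k :: t2_space, 'x :: banach_lattice) c0 \<Rightarrow> ('k, 'x) c0"
  assumes K: "locally_compact_space (euclidean :: 'k topology)"
    and T: "eps_band_preserving \<epsilon> T"
    and U: "open U" "t \<in> U" "\<And>s. s \<in> U \<Longrightarrow> apply_c0 f s = 0"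
  shows "norm (apply_c0 (T f) t) \<le> \<epsilon> * norm f"
proof -
  obtain \<phi> W where \<phi>: "continuous_on UNIV \<phi>" "\<And>s. 0 \<le> \<phi> s" "\<And>s. \<phi> s \<le> (1::real)"
    "\<And>s. s \<notin> U \<Longrightarrow> \<phi> s = 0" "open W" "t \<in> W" "\<And>s. s \<in> W \<Longrightarrow> \<phi> s = 1"
    using completely_regular_bump[OF K U(1,2)] by metis
  obtain y where y: "\<And>s. apply_c0 y s = \<phi> s *\<^sub>R apply_c0 \<bar>T f\<bar> s"
    using c0_scale_bump[OF \<phi>(1-3), of "\<bar>T f\<bar>"] by metis
  have y0: "0 \<le> y"
    by (auto simp: less_eq_c0.rep_eq zero_c0.rep_eq y apply_c0_abs intro!: scaleR_nonneg_nonneg \<phi>)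
  have disj: "disjoint_elems y f"
    unfolding disjoint_elems_def
  proof (rule c0_eqI)
    fix s
    show "apply_c0 (inf \<bar>y\<bar> \<bar>f\<bar>) s = apply_c0 0 s"
      using U(3)[of s] \<phi>(4)[of s]
      by (cases "s \<in> U")
        (simp_all add: inf_c0.rep_eq apply_c0_abs zero_c0.rep_eq y inf_absorb1 inf_absorb2)
  qed
  have "apply_c0 (inf \<bar>T f\<bar> y) t = \<bar>apply_c0 (T f) t\<bar>"
    using \<phi>(6,7) by (simp add: inf_c0.rep_eq y apply_c0_abs)
  then have "norm (apply_c0 (T f) t) \<le> norm (inf \<bar>T f\<bar> y)"
    using norm_apply_c0_le[of "inf \<bar>T f\<bar> y" t] by (simp add: norm_abs_lattice)
  also have "\<dots> \<le> \<epsilon> * norm f" by (rule eps_band_preservingD[OF T y0 disj])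
  finally show ?thesis .
qed

section \<open>Gliding hump at a point that is not isolated\<close>

lemma summable_geometric_scaleR:
  fixes g :: "nat \<Rightarrow> 'a :: banach"
  assumes "\<And>n. norm (g n) \<le> 1"
  shows "summable (\<lambda>n. (1/2) ^ n *\<^sub>R g n)"
proof (rule summable_comparison_test')
  show "summable (\<lambda>n. (1/2 :: real) ^ n)" by (simp add: summable_geometric)
  show "norm ((1/2) ^ n *\<^sub>R g n) \<le> (1/2) ^ n" if "n \<ge> 0" for n
    using mult_left_mono[OF assms, of "(1/2) ^ n" n] by simp
qed

text \<open>One step of the gliding hump: the hump \<open>f\<close> lives in \<open>W\<close>, and
  \<open>V'\<close> is the smaller neighbourhood of \<open>t\<close>, disjoint from
  \<open>W\<close>, in which the next step takes place.\<close>

lemma eps_band_preserving_bump_at_limit_point: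
  fixes T :: "('k :: t2_space, 'x :: banach_lattice) c0 \<Rightarrow> ('k, 'x) c0"
  assumes K: "locally_compact_space (euclidean :: 'k topology)"
    and \<epsilon>: "0 \<le> \<epsilon>" and lin: "linear T" and T: "eps_band_preserving \<epsilon> T"
    and t: "\<not> open {t}"
    and unbdd: "\<And>C. \<exists>f. norm f \<le> 1 \<and> norm (apply_c0 (T f) t) > C"
    and V: "open V" "t \<in> V"
  shows "\<exists>V' f W s. open V' \<and> t \<in> V' \<and> V' \<subseteq> V \<and> open W \<and> W \<subseteq> V \<and> W \<inter> V' = {} \<and> s \<in> W \<and>
    norm f \<le> 1 \<and> (\<forall>r. r \<notin> W \<longrightarrow> apply_c0 f r = 0) \<and> norm (apply_c0 (T f) s) \<ge> N"
proof -
  \<comment> \<open>The surplus \<epsilon> pays for replacing \<open>g\<close> by its localisation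
    \<open>f\<close> below.\<close>
  obtain g where g: "norm g \<le> 1" "norm (apply_c0 (T g) t) > N + \<epsilon>" using unbdd by blast
  define O' where "O' = {s. norm (apply_c0 (T g) s) > N + \<epsilon>} \<inter> V"
  have "continuous_on UNIV (apply_c0 (T g))" using apply_c0[of "T g"] by simp
  then have "open O'" unfolding O'_def
    by (intro open_Int open_Collect_less continuous_intros V)
  moreover have "t \<in> O'" using g V by (simp add: O'_def)
  \<comment> \<open>An open set containing \<open>t\<close> cannot be \<open>{t}\<close>, so
    \<open>T g\<close> is large at a second point \<open>s\<close> as well.\<close>
  ultimately have "O' \<noteq> {t}" using t by auto
  then obtain s where s: "s \<in> O'" "s \<noteq> t" using \<open>t \<in> O'\<close> by blast
  obtain W0 V0 where WV: "open W0" "open V0" "s \<in> W0" "t \<in> V0" "W0 \<inter> V0 = {}"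
    using hausdorff[OF s(2)] by blast
  define W where "W = W0 \<inter> V"
  have W: "open W" "s \<in> W" using WV s V by (auto simp: W_def O'_def)
  obtain \<phi> W1 where \<phi>: "continuous_on UNIV \<phi>" "\<And>s. 0 \<le> \<phi> s" "\<And>s. \<phi> s \<le> (1::real)"
    "\<And>s. s \<notin> W \<Longrightarrow> \<phi> s = 0" "open W1" "s \<in> W1" "\<And>s. s \<in> W1 \<Longrightarrow> \<phi> s = 1"
    using completely_regular_bump[OF K W] by metis
  obtain f where f: "\<And>s. apply_c0 f s = \<phi> s *\<^sub>R apply_c0 g s"
    using c0_scale_bump[OF \<phi>(1-3), of g] by metis
  have le: "norm (c *\<^sub>R apply_c0 g r) \<le> 1" if "0 \<le> c" "c \<le> 1" for c r
    using norm_apply_c0_le[of g r] g(1) that by (simp add: mult_le_one)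
  have f1: "norm f \<le> 1" by (rule norm_c0_le) (simp only: f le \<phi>)
  have "apply_c0 (g - f) r = (1 - \<phi> r) *\<^sub>R apply_c0 g r" for r
    by (simp add: minus_c0.rep_eq f scaleR_left_diff_distrib)
  then have gf1: "norm (g - f) \<le> 1" by (intro norm_c0_le) (simp add: le \<phi> del: norm_scaleR)
  \<comment> \<open>The cutoff is 1 on \<open>W1\<close>, so \<open>g - f\<close> vanishes near
    \<open>s\<close>, and passing from \<open>g\<close> to \<open>f\<close> changes the value at
    \<open>s\<close> by at most \<epsilon>.\<close>
  have "norm (apply_c0 (T (g - f)) s) \<le> \<epsilon> * norm (g - f)"
    by (rule eps_band_preserving_local[OF K T \<phi>(5,6)]) (simp add: minus_c0.rep_eq f \<phi>)
  also have "\<dots> \<le> \<epsilon>" using gf1 \<epsilon> by (simp add: mult_left_le)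
  finally have "norm (apply_c0 (T g) s - apply_c0 (T f) s) \<le> \<epsilon>"
    by (simp add: linear_diff[OF lin] minus_c0.rep_eq)
  moreover have "norm (apply_c0 (T g) s) > N + \<epsilon>" using s by (simp add: O'_def)
  ultimately have "norm (apply_c0 (T f) s) \<ge> N"
    using norm_triangle_ineq2[of "apply_c0 (T g) s" "apply_c0 (T f) s"] by linarith
  moreover have "apply_c0 f r = 0" if "r \<notin> W" for r using \<phi>(4)[OF that] by (simp add: f)
  moreover have "open (V \<inter> V0)" "t \<in> V \<inter> V0" "V \<inter> V0 \<subseteq> V" "W \<subseteq> V" "W \<inter> (V \<inter> V0) = {}"
    using WV V by (auto simp: W_def)
  ultimately show ?thesis
    using f1 W by blast
qed

lemma linear_unbounded_imp_large_on_unit_ball: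
  fixes L :: "'a :: real_normed_vector \<Rightarrow> 'b :: real_normed_vector"
  assumes "linear L" "\<nexists>C. \<forall>x. norm (L x) \<le> C * norm x"
  shows "\<exists>x. norm x \<le> 1 \<and> norm (L x) > C"
proof -
  have "\<not> (\<forall>x. norm (L x) \<le> \<bar>C\<bar> * norm x)" using assms(2) by blast
  then obtain x where x: "norm (L x) > \<bar>C\<bar> * norm x" by (auto simp: not_le)
  then have "x \<noteq> 0" using linear_0[OF assms(1)] by auto
  then have "norm (L x) / norm x > \<bar>C\<bar>" using x by (simp add: less_divide_eq)
  then have "norm (L ((1 / norm x) *\<^sub>R x)) > C"
    by (simp add: linear_scale[OF assms(1)])
  moreover have "norm ((1 / norm x) *\<^sub>R x) \<le> 1" by simp
  ultimately show ?thesis by blast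
qed

text \<open>Humps with disjoint supports \<open>W n\<close> near \<open>t\<close> are added with
  weights \<open>(1/2) ^ n\<close>. On \<open>W n\<close> the sum \<open>F\<close> coincides with
  its \<open>n\<close>-th term, so by locality \<open>T F\<close> is about as large at
  \<open>s n\<close> as the image of that term, which contradicts the finiteness of
  \<open>norm (T F)\<close>.\<close>

lemma eps_band_preserving_bounded_at_limit_point:
  fixes T :: "('k :: t2_space, 'x :: banach_lattice) c0 \<Rightarrow> ('k, 'x) c0"
  assumes K: "locally_compact_space (euclidean :: 'k topology)"
    and \<epsilon>: "0 \<le> \<epsilon>" and lin: "linear T" and T: "eps_band_preserving \<epsilon> T"
    and t: "\<not> open {t}"
  shows "\<exists>C. \<forall>f. norm (apply_c0 (T f) t) \<le> C * norm f"
proof (rule ccontr)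
  assume neg: "\<nexists>C. \<forall>f. norm (apply_c0 (T f) t) \<le> C * norm f"
  have "linear (\<lambda>f. apply_c0 (T f) t)"
    using linear_compose[OF lin bounded_linear.linear[OF bounded_linear_apply_c0]]
    by (simp add: o_def)
  then have unbdd: "\<exists>f. norm f \<le> 1 \<and> norm (apply_c0 (T f) t) > C" for C
    using linear_unbounded_imp_large_on_unit_ball neg by blast
  \<comment> \<open>The size \<open>2 ^ n * real n\<close> is chosen so that \<open>n\<close>
    remains after the weight \<open>(1/2) ^ n\<close> is applied.\<close>
  define Q where "Q n V V' f W s \<longleftrightarrow> V' \<subseteq> V \<and> open W \<and> W \<subseteq> V \<and> W \<inter> V' = {} \<and> s \<in> W \<and>
    norm f \<le> 1 \<and> (\<forall>r. r \<notin> W \<longrightarrow> apply_c0 f r = 0) \<and> norm (apply_c0 (T f) s) \<ge> 2 ^ n * real n"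
    for n V V' f W s
  \<comment> \<open>Only the shrinking neighbourhoods are chosen recursively; the humps are picked
    afterwards, one for each pair \<open>V n\<close>, \<open>V (Suc n)\<close>.\<close>
  have "\<exists>V. \<forall>n. (open (V n) \<and> t \<in> V n) \<and> (\<exists>f W s. Q n (V n) (V (Suc n)) f W s)"
  proof (rule dependent_nat_choice)
    show "\<exists>V. open V \<and> t \<in> V" by (rule exI[of _ UNIV]) simp
    fix V n assume V: "open V \<and> t \<in> V"
    from eps_band_preserving_bump_at_limit_point[OF K \<epsilon> lin T t unbdd V[THEN conjunct1]
        V[THEN conjunct2], of "2 ^ n * real n"]
    obtain V' f W s where "open V'" "t \<in> V'" "Q n V V' f W s" unfolding Q_def by metis
    then show "\<exists>V'. (open V' \<and> t \<in> V') \<and> (\<exists>f W s. Q n V V' f W s)" by blast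
  qed
  then obtain V where "\<forall>n. \<exists>f W s. Q n (V n) (V (Suc n)) f W s" by blast
  then obtain f W s where Q: "\<And>n. Q n (V n) (V (Suc n)) (f n) (W n) (s n)" by metis
  have dec: "V m \<subseteq> V n" if "n \<le> m" for m n
    using that by (rule lift_Suc_antimono_le[of V, rotated]) (use Q in \<open>auto simp: Q_def\<close>)
  \<comment> \<open>\<open>W n\<close> lies in \<open>V n\<close>, hence in
    \<open>V (Suc m)\<close>, which misses \<open>W m\<close>.\<close>
  have disj: "W m \<inter> W n = {}" if "m < n" for m n
    using Q[of m] Q[of n] dec[of "Suc m" n] that unfolding Q_def by (auto simp: Suc_le_eq)
  define h where "h n = (1/2) ^ n *\<^sub>R f n" for n
  have sum: "summable h" unfolding h_def
    by (rule summable_geometric_scaleR) (use Q in \<open>auto simp: Q_def\<close>)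
  define F where "F = suminf h"
  \<comment> \<open>Evaluation is continuous, so the series may be summed at \<open>r\<close>, where
    only the \<open>n\<close>-th term can be nonzero.\<close>
  have F: "apply_c0 F r = apply_c0 (h n) r" if "r \<in> W n" for r n
  proof -
    have "(\<lambda>k. apply_c0 (h k) r) sums apply_c0 F r"
      unfolding F_def using bounded_linear.sums[OF bounded_linear_apply_c0 summable_sums[OF sum]] .
    moreover have "apply_c0 (h k) r = 0" if "k \<noteq> n" for k
    proof -
      have "r \<notin> W k" using disj[of k n] disj[of n k] that \<open>r \<in> W n\<close> by (auto simp: neq_iff)
      then show ?thesis using Q[of k] by (simp add: Q_def h_def scaleR_c0.rep_eq)
    qed
    then have "(\<lambda>k. apply_c0 (h k) r) sums (\<Sum>k\<in>{n}. apply_c0 (h k) r)"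
      by (intro sums_finite) auto
    ultimately show ?thesis using sums_unique2 by fastforce
  qed
  have h1: "norm (h n) \<le> 1" for n
  proof -
    have "norm (f n) \<le> 1" using Q[of n] by (simp add: Q_def)
    then show ?thesis by (simp add: h_def power_one_over field_simps)
      (meson one_le_numeral one_le_power order_trans)
  qed
  \<comment> \<open>The bound is independent of \<open>n\<close>; the summand 1 in it estimates
    \<open>norm (h n)\<close>.\<close>
  have "real n \<le> norm (T F) + \<epsilon> * (norm F + 1)" for n
  proof -
    have W: "open (W n)" "s n \<in> W n" using Q[of n] by (auto simp: Q_def)
    have "norm (apply_c0 (T (F - h n)) (s n)) \<le> \<epsilon> * norm (F - h n)"
      by (rule eps_band_preserving_local[OF K T W]) (simp add: minus_c0.rep_eq F)
    also have "\<dots> \<le> \<epsilon> * (norm F + 1)"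
      using norm_triangle_ineq4[of F "h n"] h1[of n] by (intro mult_left_mono \<epsilon>) linarith
    finally have "norm (apply_c0 (T F) (s n) - apply_c0 (T (h n)) (s n)) \<le> \<epsilon> * (norm F + 1)"
      by (simp add: linear_diff[OF lin] minus_c0.rep_eq)
    moreover have "real n \<le> norm (apply_c0 (T (h n)) (s n))"
      using Q[of n] by (simp add: Q_def h_def linear_scale[OF lin] scaleR_c0.rep_eq field_simps)
    ultimately show ?thesis
      using norm_triangle_ineq2[of "apply_c0 (T (h n)) (s n)" "apply_c0 (T F) (s n)"]
        norm_apply_c0_le[of "T F" "s n"] by (simp add: norm_minus_commute)
  qed
  then show False using reals_Archimedean2 by (meson not_le)
qed

section \<open>Band projections in Koethe function spaces\<close>

context koethe_function_space
begin

section \<open>Norm and absolute value through representatives\<close>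

lemma rep_zero: "AE w in M. rep 0 w = 0"
  using rep_scaleR[of 0 0] by simp

text \<open>The ideal property only provides some class with the representative of \<open>x\<close>
  and small norm; \<open>rep_inject\<close> identifies that class with \<open>x\<close>.\<close>

lemma norm_mono_rep:
  assumes "AE w in M. \<bar>rep x w\<bar> \<le> \<bar>rep y w\<bar>"
  shows "norm x \<le> norm y"
proof -
  obtain z where z: "AE w in M. rep z w = rep x w" "norm z \<le> norm y"
    using rep_ideal[OF rep_measurable assms] by blast
  then show ?thesis using rep_inject[of z x] by simp
qed

lemma rep_uminus: "AE w in M. rep (- x) w = - rep x w"
  using rep_scaleR[of "-1" x] by simp

text \<open>The absolute value on the left is a lattice operation. The pointwise absolute value
  defines a class \<open>z\<close> above \<open>x\<close> and \<open>- x\<close>, so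
  \<open>\<bar>x\<bar> \<le> z\<close>; conversely \<open>\<bar>x\<bar>\<close> dominates both
  \<open>x\<close> and \<open>- x\<close> almost everywhere.\<close>

lemma rep_abs: "AE w in M. rep \<bar>x\<bar> w = \<bar>rep x w\<bar>"
proof -
  have "(\<lambda>w. \<bar>rep x w\<bar>) \<in> borel_measurable M" using rep_measurable[of x] by measurable
  then obtain z where z: "AE w in M. rep z w = \<bar>rep x w\<bar>"
    using rep_ideal[of "\<lambda>w. \<bar>rep x w\<bar>" x] by auto
  have "x \<le> z" unfolding rep_le_iff using z by eventually_elim simp
  moreover have "- x \<le> z" unfolding rep_le_iff using z rep_uminus[of x] by eventually_elim simp
  ultimately have "\<bar>x\<bar> \<le> z" by (rule abs_leI)
  then have "AE w in M. rep \<bar>x\<bar> w \<le> rep z w" by (simp add: rep_le_iff)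
  moreover have "AE w in M. rep x w \<le> rep \<bar>x\<bar> w"
    using abs_ge_self[of x] by (simp only: rep_le_iff)
  moreover have "AE w in M. rep (- x) w \<le> rep \<bar>x\<bar> w"
    using abs_ge_minus_self[of x] by (simp only: rep_le_iff)
  ultimately show ?thesis using z rep_uminus[of x] by eventually_elim auto
qed

section \<open>Band projections\<close>

text \<open>Multiplication by an indicator, carried out on classes. For measurable \<open>A\<close>
  the chosen class exists by \<open>rep_ideal\<close> and is unique by
  \<open>rep_inject\<close>.\<close>

definition band_proj :: "'w set \<Rightarrow> 'x \<Rightarrow> 'x"
  where "band_proj A x = (SOME z. AE w in M. rep z w = indicator A w * rep x w)"

lemma rep_band_proj:
  assumes "A \<in> sets M"
  shows "AE w in M. rep (band_proj A x) w = indicator A w * rep x w"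
proof -
  have "(\<lambda>w. indicator A w * rep x w) \<in> borel_measurable M"
    using rep_measurable[of x] assms by measurable
  moreover have "AE w in M. \<bar>indicator A w * rep x w\<bar> \<le> \<bar>rep x w\<bar>"
    by (auto simp: indicator_def)
  ultimately have "\<exists>z. AE w in M. rep z w = indicator A w * rep x w"
    using rep_ideal by blast
  then show ?thesis unfolding band_proj_def by (rule someI_ex)
qed

lemma band_proj_eqI:
  assumes "A \<in> sets M" "AE w in M. rep z w = indicator A w * rep x w"
  shows "band_proj A x = z"
proof (rule rep_inject)
  show "AE w in M. rep (band_proj A x) w = rep z w"
    using assms(2) rep_band_proj[OF assms(1), of x] by eventually_elim simp
qed

lemma norm_band_proj_le:
  assumes "A \<in> sets M" shows "norm (band_proj A x) \<le> norm x"
  by (rule norm_mono_rep)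
    (use rep_band_proj[OF assms, of x] in \<open>eventually_elim, auto simp: indicator_def\<close>)

lemma bounded_linear_band_proj:
  assumes A: "A \<in> sets M" shows "bounded_linear (band_proj A)"
proof (rule bounded_linear_intro[where K = 1])
  fix x y and c :: real
  have "AE w in M. rep (band_proj A x + band_proj A y) w = indicator A w * rep (x + y) w"
    using rep_band_proj[OF A, of x] rep_band_proj[OF A, of y] rep_add[of x y]
      rep_add[of "band_proj A x" "band_proj A y"]
    by eventually_elim (simp add: algebra_simps)
  then show "band_proj A (x + y) = band_proj A x + band_proj A y" by (rule band_proj_eqI[OF A])
  have "AE w in M. rep (c *\<^sub>R band_proj A x) w = indicator A w * rep (c *\<^sub>R x) w"
    using rep_band_proj[OF A, of x] rep_scaleR[of c x] rep_scaleR[of c "band_proj A x"]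
    by eventually_elim simp
  then show "band_proj A (c *\<^sub>R x) = c *\<^sub>R band_proj A x" by (rule band_proj_eqI[OF A])
  show "norm (band_proj A x) \<le> norm x * 1" using norm_band_proj_le[OF A] by simp
qed

lemma band_proj_band_proj:
  assumes "A \<in> sets M" "B \<in> sets M"
  shows "band_proj A (band_proj B x) = band_proj (A \<inter> B) x"
proof (rule band_proj_eqI[OF assms(1)])
  show "AE w in M. rep (band_proj (A \<inter> B) x) w = indicator A w * rep (band_proj B x) w"
    using rep_band_proj[OF assms(2), of x] rep_band_proj[OF sets.Int[OF assms], of x]
    by eventually_elim (simp add: indicator_inter_arith)
qed

lemma band_proj_Un:
  assumes "A \<in> sets M" "B \<in> sets M" "A \<inter> B = {}"
  shows "band_proj (A \<union> B) x = band_proj A x + band_proj B x"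
proof (rule band_proj_eqI)
  show "AE w in M. rep (band_proj A x + band_proj B x) w = indicator (A \<union> B) w * rep x w"
    using rep_band_proj[OF assms(1), of x] rep_band_proj[OF assms(2), of x]
      rep_add[of "band_proj A x" "band_proj B x"]
    by eventually_elim (use assms(3) in \<open>auto simp: indicator_def\<close>)
qed (use assms in auto)

lemma band_proj_space: "band_proj (space M) x = x"
  by (rule band_proj_eqI) (auto intro!: AE_I2)

lemma band_proj_null:
  assumes "A \<in> null_sets M" shows "band_proj A x = 0"
proof (rule band_proj_eqI)
  show "AE w in M. rep 0 w = indicator A w * rep x w"
    using rep_zero AE_not_in[OF assms] by eventually_elim simp
qed (use assms in auto)

text \<open>The infimum lies between 0 and both absolute values, and almost everywhere one of these
  vanishes.\<close>

lemma disjoint_band_proj: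
  assumes A: "A \<in> sets M" and B: "B \<in> sets M" and AB: "A \<inter> B = {}"
  shows "disjoint_elems (band_proj A x) (band_proj B y)"
proof -
  let ?w = "inf \<bar>band_proj A x\<bar> \<bar>band_proj B y\<bar>"
  have "?w \<le> \<bar>band_proj A x\<bar>" "?w \<le> \<bar>band_proj B y\<bar>" "0 \<le> ?w" by simp_all
  then have "AE w in M. rep ?w w \<le> rep \<bar>band_proj A x\<bar> w" "AE w in M. rep ?w w \<le> rep \<bar>band_proj B y\<bar> w"
    "AE w in M. rep 0 w \<le> rep ?w w"
    by (simp_all only: rep_le_iff)
  then have "AE w in M. rep ?w w = rep 0 w"
    using rep_zero rep_abs[of "band_proj A x"] rep_abs[of "band_proj B y"]
      rep_band_proj[OF A, of x] rep_band_proj[OF B, of y]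
  proof eventually_elim
    case (elim w)
    then show ?case using AB by (cases "w \<in> A"; cases "w \<in> B") auto
  qed
  then show ?thesis unfolding disjoint_elems_def by (rule rep_inject)
qed

lemma band_proj_abs:
  assumes A: "A \<in> sets M"
  shows "band_proj A \<bar>x\<bar> = \<bar>band_proj A x\<bar>"
proof (rule band_proj_eqI[OF A])
  show "AE w in M. rep \<bar>band_proj A x\<bar> w = indicator A w * rep \<bar>x\<bar> w"
    using rep_band_proj[OF A, of x] rep_abs[of "band_proj A x"] rep_abs[of x]
    by eventually_elim (simp add: abs_mult)
qed

lemma band_proj_abs_le:
  assumes A: "A \<in> sets M"
  shows "band_proj A \<bar>x\<bar> \<le> \<bar>x\<bar>"
  unfolding rep_le_iff using rep_band_proj[OF A, of "\<bar>x\<bar>"] rep_abs[of x]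
  by eventually_elim (simp add: indicator_def)

section \<open>The Fatou property along increasing sequences of sets\<close>

text \<open>The projections of \<open>\<bar>z\<bar>\<close> to the sets \<open>B n\<close> form an
  increasing sequence whose least upper bound is the projection to the union. Passing from
  \<open>z\<close> to \<open>\<bar>z\<bar>\<close> makes them nonnegative without changing
  norms.\<close>

lemma fatou_norm_band_proj:
  assumes "fatou_norm TYPE('x)"
  obtains C where "0 \<le> C" "\<And>B z m. \<lbrakk>range B \<subseteq> sets M; incseq B; \<And>n::nat. norm (band_proj (B n) z) \<le> m\<rbrakk>
    \<Longrightarrow> norm (band_proj (\<Union>n. B n) z) \<le> C * m"
proof -
  obtain C where C: "\<forall>(I :: nat set) r (x :: nat \<Rightarrow> 'x) s.
      increasing_net I r x \<longrightarrow> (\<forall>i\<in>I. 0 \<le> x i) \<longrightarrow> bdd_above ((\<lambda>i. norm (x i)) ` I) \<longrightarrow>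
      isLub UNIV (x ` I) s \<longrightarrow> norm s \<le> C * (SUP i\<in>I. norm (x i))"
    using fatou_norm_net[OF assms] by (elim exE)
  \<comment> \<open>The Fatou property does not fix the sign of its constant, while a nonnegative
    one is claimed.\<close>
  have "norm (band_proj (\<Union>n. B n) z) \<le> \<bar>C\<bar> * m"
    if B: "range B \<subseteq> sets M" "incseq B" and m: "\<And>n::nat. norm (band_proj (B n) z) \<le> m" for B z m
  proof -
    define x where "x n = band_proj (B n) \<bar>z\<bar>" for n
    have Bn: "B n \<in> sets M" for n using B(1) by auto
    then have UB: "(\<Union>n. B n) \<in> sets M" by auto
    have rx: "AE w in M. rep (x n) w = indicator (B n) w * rep \<bar>z\<bar> w" for n
      unfolding x_def by (rule rep_band_proj[OF Bn])
    have rU: "AE w in M. rep (band_proj (\<Union>n. B n) \<bar>z\<bar>) w = indicator (\<Union>n. B n) w * rep \<bar>z\<bar> w"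
      by (rule rep_band_proj[OF UB])
    have rz: "AE w in M. 0 \<le> rep \<bar>z\<bar> w" using rep_abs[of z] by eventually_elim simp
    have "x i \<le> x j" if "i \<le> j" for i j
      unfolding rep_le_iff using rx[of i] rx[of j] rz
      by eventually_elim (use incseqD[OF B(2) that] in \<open>auto simp: indicator_def\<close>)
    moreover have "\<exists>k. i \<le> k \<and> j \<le> k" for i j :: nat
      by (rule exI[of _ "max i j"]) simp
    ultimately have 1: "increasing_net UNIV (\<le>) x"
      unfolding increasing_net_def by auto
    have 2: "\<forall>i\<in>UNIV. 0 \<le> x i"
    proof
      fix i
      show "0 \<le> x i" unfolding rep_le_iff using rx[of i] rz rep_zero
        by eventually_elim (auto simp: indicator_def)
    qed
    have nx: "norm (x n) \<le> m" for n
      using m[of n] by (simp add: x_def band_proj_abs[OF Bn] norm_abs_lattice)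
    have 3: "bdd_above ((\<lambda>i. norm (x i)) ` UNIV)" using nx by (intro bdd_aboveI2)
    have 4: "isLub UNIV (x ` UNIV) (band_proj (\<Union>n. B n) \<bar>z\<bar>)"
    proof (rule isLubI2)
      show "isUb UNIV (x ` UNIV) (band_proj (\<Union>n. B n) \<bar>z\<bar>)"
      proof (rule isUbI)
        show "x ` UNIV *<= band_proj (\<Union>n. B n) \<bar>z\<bar>"
        proof (rule setleI, clarify)
          fix n show "x n \<le> band_proj (\<Union>n. B n) \<bar>z\<bar>"
            unfolding rep_le_iff using rx[of n] rU rz
            by eventually_elim (auto simp: indicator_def)
        qed
      qed simp
      show "band_proj (\<Union>n. B n) \<bar>z\<bar> <=* Collect (isUb UNIV (x ` UNIV))"
      proof (rule setgeI, clarify)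
        fix u assume "isUb UNIV (x ` UNIV) u"
        then have ub: "x n \<le> u" for n by (auto simp: isUb_def setle_def)
        \<comment> \<open>As there are countably many indices, one null set serves all of them, and
          the bound by \<open>u\<close> can be read off pointwise.\<close>
        then have "AE w in M. \<forall>n. rep (x n) w \<le> rep u w" by (simp add: rep_le_iff AE_all_countable)
        moreover have "AE w in M. \<forall>n. rep (x n) w = indicator (B n) w * rep \<bar>z\<bar> w"
          using rx by (simp add: AE_all_countable)
        moreover have "0 \<le> u" using ub[of 0] 2 by (meson UNIV_I order_trans)
        then have "AE w in M. rep 0 w \<le> rep u w" by (simp only: rep_le_iff)
        ultimately have "AE w in M. rep (band_proj (\<Union>n. B n) \<bar>z\<bar>) w \<le> rep u w"
          using rU rep_zero
        proof eventually_elim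
          case (elim w)
          show ?case
          proof (cases "w \<in> (\<Union>n. B n)")
            case True
            then obtain n where "w \<in> B n" by blast
            then show ?thesis using elim(1)[rule_format, of n] elim(2)[rule_format, of n] elim(4) True by simp
          next
            case False
            then show ?thesis using elim by simp
          qed
        qed
        then show "band_proj (\<Union>n. B n) \<bar>z\<bar> \<le> u" by (simp add: rep_le_iff)
      qed
    qed
    have "norm (band_proj (\<Union>n. B n) z) = norm (band_proj (\<Union>n. B n) \<bar>z\<bar>)"
      by (simp add: band_proj_abs[OF UB] norm_abs_lattice)
    also have "\<dots> \<le> C * (SUP i. norm (x i))"
      using C[THEN spec, THEN spec, THEN spec, THEN spec, THEN mp, OF 1,
        THEN mp, OF 2, THEN mp, OF 3, THEN mp, OF 4] .
    also have "\<dots> \<le> \<bar>C\<bar> * m"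
    proof -
      have "0 \<le> (SUP i. norm (x i))" using 3 by (meson UNIV_I cSUP_upper2 norm_ge_zero)
      moreover have "(SUP i. norm (x i)) \<le> m" using nx by (intro cSUP_least) auto
      ultimately show ?thesis by (intro mult_mono) auto
    qed
    finally show ?thesis .
  qed
  then show thesis by (intro that[of "\<bar>C\<bar>"]) auto
qed

section \<open>Functions on atoms\<close>

text \<open>The constant is the mean value over \<open>E\<close>, which exists by local
  integrability. Since \<open>E\<close> is an atom, the deviation \<open>h\<close> from the mean has
  one sign almost everywhere; its integral is zero, so it vanishes.\<close>

lemma rep_constant_on_atom:
  assumes E: "E \<in> sets M" "0 < emeasure M E" "emeasure M E < \<infinity>"
    and atom: "\<And>B. B \<in> sets M \<Longrightarrow> B \<subseteq> E \<Longrightarrow> B \<in> null_sets M \<or> E - B \<in> null_sets M"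
  shows "\<exists>c. AE w in M. indicator E w * rep x w = c * indicator E w"
proof -
  define c where "c = (\<integral>w. indicator E w * rep x w \<partial>M) / measure M E"
  define h where "h w = indicator E w * rep x w - c * indicator E w" for w
  have mE: "measure M E > 0" using E by (simp add: measure_def enn2real_positive_iff)
  have int: "integrable M (\<lambda>w. indicator E w * rep x w)"
    using rep_locally_integrable[OF E(1), of x] E(3) by (simp add: set_integrable_def)
  have intE: "integrable M (\<lambda>w. c * indicator E w)"
    using E by (intro integrable_mult_right integrable_real_indicator) auto
  have inth: "integrable M h" unfolding h_def by (intro Bochner_Integration.integrable_diff int intE)
  have h0: "(\<integral>w. h w \<partial>M) = 0"
    unfolding h_def using mE E sets.Int_space_eq2[OF E(1)]
    by (subst Bochner_Integration.integral_diff[OF int intE]) (simp add: c_def)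
  define B where "B = {w \<in> space M. w \<in> E \<and> rep x w > c}"
  have "B \<in> sets M" unfolding B_def using rep_measurable[of x] E(1) by measurable
  moreover have "B \<subseteq> E" by (auto simp: B_def)
  ultimately have "B \<in> null_sets M \<or> E - B \<in> null_sets M" by (rule atom)
  then have "AE w in M. h w = 0"
  proof
    assume "B \<in> null_sets M"
    from AE_not_in[OF this] have nn: "AE w in M. 0 \<le> - h w"
      by (rule AE_mp) (auto intro!: AE_I2 simp: B_def h_def indicator_def)
    have "integrable M (\<lambda>w. - h w)" "(\<integral>w. - h w \<partial>M) = 0" using inth h0 by auto
    then have "AE w in M. - h w = 0" using integral_nonneg_eq_0_iff_AE[of M "\<lambda>w. - h w"] nn by blast
    then show ?thesis by simp
  next
    assume "E - B \<in> null_sets M"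
    from AE_not_in[OF this] have nn: "AE w in M. 0 \<le> h w"
      by (rule AE_mp) (auto intro!: AE_I2 simp: B_def h_def indicator_def)
    then show ?thesis using integral_nonneg_eq_0_iff_AE[of M h] inth h0 by blast
  qed
  then show ?thesis unfolding h_def by auto
qed

end

section \<open>Operators with small off-diagonal blocks\<close>

text \<open>This is what the band preserving property of \<open>T\<close> leaves for the operator
  induced at an isolated point: the part of \<open>S\<close> leading from the complement of
  \<open>A\<close> into \<open>A\<close> is small, uniformly in \<open>A\<close>. Continuity of
  \<open>S\<close> is the goal.\<close>

locale almost_local_operator = koethe_function_space M rep
  for M :: "'w measure" and rep :: "'x :: banach_lattice \<Rightarrow> 'w \<Rightarrow> real" +
  fixes S :: "'x \<Rightarrow> 'x" and \<epsilon> :: real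
  assumes linear_S: "linear S" and eps_nonneg: "0 \<le> \<epsilon>" and fatou: "fatou_norm TYPE('x)"
    and almost_local: "A \<in> sets M \<Longrightarrow> norm (band_proj A (S (band_proj (space M - A) x))) \<le> \<epsilon> * norm x"
begin

section \<open>Compressions to measurable sets\<close>

text \<open>The bound is kept explicit because the Fatou argument needs a common one for a whole
  sequence of sets.\<close>

definition compression_bound :: "'w set \<Rightarrow> real \<Rightarrow> bool"
  where "compression_bound A N \<longleftrightarrow> 0 \<le> N \<and> (\<forall>x. norm (band_proj A (S (band_proj A x))) \<le> N * norm x)"

definition compression_bounded :: "'w set \<Rightarrow> bool"
  where "compression_bounded A \<longleftrightarrow> (\<exists>N. compression_bound A N)"

lemma compression_boundedI: "compression_bound A N \<Longrightarrow> compression_bounded A"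
  by (auto simp: compression_bounded_def)

lemma compression_boundD:
  "compression_bound A N \<Longrightarrow> norm (band_proj A (S (band_proj A x))) \<le> N * norm x"
  by (simp add: compression_bound_def)

lemma almost_local_disjoint:
  assumes A: "A \<in> sets M" and B: "B \<in> sets M" and AB: "A \<inter> B = {}"
  shows "norm (band_proj A (S (band_proj B x))) \<le> \<epsilon> * norm x"
proof -
  have "(space M - A) \<inter> B = B" using AB sets.sets_into_space[OF B] by auto
  then have "band_proj B x = band_proj (space M - A) (band_proj B x)"
    using A B by (simp add: band_proj_band_proj)
  then have "norm (band_proj A (S (band_proj B x))) \<le> \<epsilon> * norm (band_proj B x)"
    using almost_local[OF A, of "band_proj B x"] by simp
  also have "\<dots> \<le> \<epsilon> * norm x"
    by (intro mult_left_mono norm_band_proj_le B eps_nonneg)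
  finally show ?thesis .
qed

text \<open>The compression to \<open>B\<close> arises from that to \<open>A\<close> by projecting
  to \<open>B\<close> on both sides, and projections are contractive.\<close>

lemma compression_bound_subset:
  assumes "A \<in> sets M" "B \<in> sets M" "B \<subseteq> A" and A: "compression_bound A N"
  shows "compression_bound B N"
  unfolding compression_bound_def
proof (intro conjI allI)
  show N: "0 \<le> N" using A by (simp add: compression_bound_def)
  fix x
  have BA: "B \<inter> A = B" "A \<inter> B = B" using assms by auto
  have "norm (band_proj B (S (band_proj B x))) = norm (band_proj B (band_proj A (S (band_proj A (band_proj B x)))))"
    using assms(1,2) by (simp add: band_proj_band_proj BA)
  also have "\<dots> \<le> norm (band_proj A (S (band_proj A (band_proj B x))))"
    by (rule norm_band_proj_le[OF assms(2)])
  also have "\<dots> \<le> N * norm (band_proj B x)" by (rule compression_boundD[OF A])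
  also have "\<dots> \<le> N * norm x" by (intro mult_left_mono norm_band_proj_le assms N)
  finally show "norm (band_proj B (S (band_proj B x))) \<le> N * norm x" .
qed

text \<open>Of the four blocks, the diagonal ones are bounded by \<open>N\<close> and
  \<open>N'\<close>, the two off-diagonal ones by \<epsilon> each.\<close>

lemma compression_bound_disjoint_Un:
  assumes A: "A \<in> sets M" and B: "B \<in> sets M" and AB: "A \<inter> B = {}"
    and bA: "compression_bound A N" and bB: "compression_bound B N'"
  shows "compression_bound (A \<union> B) (N + N' + 2 * \<epsilon>)"
  unfolding compression_bound_def
proof (intro conjI allI)
  show "0 \<le> N + N' + 2 * \<epsilon>" using bA bB eps_nonneg by (simp add: compression_bound_def)
  fix x
  have "S (band_proj (A \<union> B) x) = S (band_proj A x) + S (band_proj B x)"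
    by (simp add: band_proj_Un[OF A B AB] linear_add[OF linear_S])
  then have "band_proj (A \<union> B) (S (band_proj (A \<union> B) x)) =
    (band_proj A (S (band_proj A x)) + band_proj A (S (band_proj B x))) +
    (band_proj B (S (band_proj A x)) + band_proj B (S (band_proj B x)))" (is "_ = (?a + ?b) + (?c + ?d)")
    using bounded_linear_band_proj[OF A] bounded_linear_band_proj[OF B]
    by (simp add: band_proj_Un[OF A B AB] linear_simps(1))
  moreover have "norm ((?a + ?b) + (?c + ?d)) \<le> (norm ?a + norm ?b) + (norm ?c + norm ?d)"
    by (intro norm_triangle_le add_mono norm_triangle_ineq)
  moreover have "norm ?b \<le> \<epsilon> * norm x" by (rule almost_local_disjoint[OF A B AB])
  moreover have "norm ?c \<le> \<epsilon> * norm x" using AB by (intro almost_local_disjoint[OF B A]) auto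
  moreover note compression_boundD[OF bA, of x] compression_boundD[OF bB, of x]
  ultimately show "norm (band_proj (A \<union> B) (S (band_proj (A \<union> B) x))) \<le> (N + N' + 2 * \<epsilon>) * norm x"
    by (simp add: algebra_simps)
qed

lemma compression_bounded_Un:
  assumes A: "A \<in> sets M" and B: "B \<in> sets M"
    and "compression_bounded A" "compression_bounded B"
  shows "compression_bounded (A \<union> B)"
proof -
  obtain N N' where N: "compression_bound A N" "compression_bound B N'"
    using assms(3,4) by (auto simp: compression_bounded_def)
  have "compression_bound (B - A) N'" using A B by (intro compression_bound_subset[OF B _ _ N(2)]) auto
  then have "compression_bound (A \<union> (B - A)) (N + N' + 2 * \<epsilon>)"
    using A B N by (intro compression_bound_disjoint_Un) auto
  then show ?thesis by (simp add: compression_boundedI)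
qed

text \<open>Projected to \<open>B n\<close>, the image of the part of \<open>x\<close> inside
  \<open>B n\<close> is controlled by \<open>N\<close> and that of the rest by \<epsilon>. This
  estimate does not depend on \<open>n\<close>, so the Fatou property passes it to the
  union.\<close>

lemma compression_bounded_incseq:
  assumes B: "range B \<subseteq> sets M" "incseq B" and bB: "\<And>n::nat. compression_bound (B n) N"
  shows "compression_bounded (\<Union>n. B n)"
proof -
  obtain C where C: "0 \<le> C" "\<And>B z m. \<lbrakk>range B \<subseteq> sets M; incseq B; \<And>n::nat. norm (band_proj (B n) z) \<le> m\<rbrakk>
    \<Longrightarrow> norm (band_proj (\<Union>n. B n) z) \<le> C * m"
    using fatou_norm_band_proj[OF fatou] by metis
  have Bn: "B n \<in> sets M" for n using B(1) by auto
  then have UB: "(\<Union>n. B n) \<in> sets M" by auto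
  have N: "0 \<le> N" using bB by (simp add: compression_bound_def)
  have "norm (band_proj (\<Union>n. B n) (S (band_proj (\<Union>n. B n) x))) \<le> C * ((N + \<epsilon>) * norm x)" for x
  proof (rule C(2)[OF B])
    fix n
    let ?D = "(\<Union>n. B n) - B n"
    have D: "?D \<in> sets M" "B n \<inter> ?D = {}" "B n \<union> ?D = (\<Union>n. B n)" using Bn UB by auto
    have "band_proj (\<Union>n. B n) x = band_proj (B n) x + band_proj ?D x"
      using band_proj_Un[OF Bn D(1,2), of x] D(3) by simp
    then have "band_proj (B n) (S (band_proj (\<Union>n. B n) x)) =
      band_proj (B n) (S (band_proj (B n) x)) + band_proj (B n) (S (band_proj ?D x))"
      using bounded_linear_band_proj[OF Bn[of n]]
      by (simp add: linear_add[OF linear_S] linear_simps(1))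
    also have "norm \<dots> \<le> N * norm x + \<epsilon> * norm x"
      by (intro norm_triangle_le add_mono compression_boundD[OF bB] almost_local_disjoint[OF Bn D(1,2)])
    finally show "norm (band_proj (B n) (S (band_proj (\<Union>n. B n) x))) \<le> (N + \<epsilon>) * norm x"
      by (simp add: algebra_simps)
  qed
  then have "compression_bound (\<Union>n. B n) (C * (N + \<epsilon>))"
    using C(1) N eps_nonneg by (simp add: compression_bound_def mult.assoc)
  then show ?thesis by (rule compression_boundedI)
qed

section \<open>Gliding hump over disjoint measurable sets\<close>

text \<open>Vectors with huge images, supported in the sets \<open>A n\<close>, are added with
  weights \<open>(1/2) ^ n\<close> to a vector \<open>F\<close>. Off \<open>A n\<close> the vector
  \<open>F\<close> influences the image on \<open>A n\<close> by at most
  \<open>\<epsilon> * norm F\<close>, so \<open>S F\<close> would have to be large on every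
  \<open>A n\<close>.\<close>

lemma no_disjoint_unbounded_sequence:
  assumes A: "\<And>n. A n \<in> sets M" and disj: "\<And>m n. m \<noteq> n \<Longrightarrow> A m \<inter> A n = {}"
    and unbdd: "\<And>n. \<not> compression_bound (A n) (2 ^ n * real n)"
  shows False
proof -
  have "\<exists>x. norm x \<le> 1 \<and> norm (band_proj (A n) (S (band_proj (A n) x))) > 2 ^ n * real n" for n
  proof -
    obtain x where x: "norm (band_proj (A n) (S (band_proj (A n) x))) > 2 ^ n * real n * norm x"
      using unbdd[of n] by (auto simp: compression_bound_def not_le)
    have lin: "linear (\<lambda>x. band_proj (A n) (S (band_proj (A n) x)))"
      using linear_compose[OF linear_compose[OF bounded_linear.linear[OF bounded_linear_band_proj[OF A]] linear_S]
          bounded_linear.linear[OF bounded_linear_band_proj[OF A]]]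
      by (simp add: o_def)
    then have "x \<noteq> 0" using x linear_0[OF lin] by auto
    then have "norm (band_proj (A n) (S (band_proj (A n) ((1 / norm x) *\<^sub>R x)))) > 2 ^ n * real n"
      using x by (simp add: linear_scale[OF lin] less_divide_eq)
    moreover have "norm ((1 / norm x) *\<^sub>R x) \<le> 1" by simp
    ultimately show ?thesis by blast
  qed
  then obtain g where g: "\<And>n. norm (g n) \<le> 1"
      "\<And>n. norm (band_proj (A n) (S (band_proj (A n) (g n)))) > 2 ^ n * real n"
    by metis
  define h where "h n = (1/2) ^ n *\<^sub>R band_proj (A n) (g n)" for n
  have sum: "summable h" unfolding h_def
    by (intro summable_geometric_scaleR order_trans[OF norm_band_proj_le[OF A] g(1)])
  define F where "F = suminf h"
  \<comment> \<open>Projections are continuous and can be applied termwise; disjointness kills every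
    term but the \<open>n\<close>-th.\<close>
  have F: "band_proj (A n) F = h n" for n
  proof -
    have lin: "linear (band_proj (A k))" for k
      by (rule bounded_linear.linear[OF bounded_linear_band_proj[OF A]])
    have "(\<lambda>k. band_proj (A n) (h k)) sums band_proj (A n) F"
      unfolding F_def using bounded_linear.sums[OF bounded_linear_band_proj[OF A] summable_sums[OF sum]] .
    moreover have "band_proj (A n) (h k) = (if k = n then h n else 0)" for k
      using disj[of n k] by (simp add: h_def linear_scale[OF lin] band_proj_band_proj A band_proj_null)
    ultimately have "(\<lambda>k. if k = n then h n else 0) sums band_proj (A n) F" by simp
    then show ?thesis using sums_unique2 sums_single[of n "\<lambda>_. h n"] by blast
  qed
  have "real n \<le> norm (S F) + \<epsilon> * norm F" for n
  proof -
    let ?P = "band_proj (A n)" and ?D = "space M - A n"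
    have D: "?D \<in> sets M" "A n \<inter> ?D = {}" "A n \<union> ?D = space M" using A[of n] sets.sets_into_space by auto
    have lin: "linear ?P" by (rule bounded_linear.linear[OF bounded_linear_band_proj[OF A]])
    have "F = h n + band_proj ?D F"
      using band_proj_Un[OF A D(1,2), of F] D(3) F by (simp add: band_proj_space)
    then have "S F = S (h n) + S (band_proj ?D F)" using linear_add[OF linear_S] by metis
    then have "?P (S (h n)) = ?P (S F) - ?P (S (band_proj ?D F))"
      by (simp add: linear_add[OF lin])
    also have "norm \<dots> \<le> norm (S F) + \<epsilon> * norm F"
      by (intro order_trans[OF norm_triangle_ineq4] add_mono norm_band_proj_le A almost_local)
    finally have "norm (?P (S (h n))) \<le> norm (S F) + \<epsilon> * norm F" .
    moreover have "real n \<le> norm (?P (S (h n)))"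
      using g(2)[of n] by (simp add: h_def linear_scale[OF lin] linear_scale[OF linear_S] field_simps)
    ultimately show ?thesis by linarith
  qed
  then show False using reals_Archimedean2 by (meson not_le)
qed

section \<open>Extraction of an atom\<close>

text \<open>Otherwise every set with unbounded compression contains a part whose compression exceeds
  any prescribed bound and whose removal leaves the compression unbounded. The parts removed
  successively are disjoint and contradict \<open>no_disjoint_unbounded_sequence\<close>.\<close>

lemma exists_indecomposable:
  assumes "\<not> compression_bounded (space M)"
  shows "\<exists>A N. A \<in> sets M \<and> \<not> compression_bounded A \<and>
    (\<forall>B\<in>sets M. B \<subseteq> A \<longrightarrow> \<not> compression_bounded (A - B) \<longrightarrow> compression_bound B N)"
proof (rule ccontr)
  assume neg: "\<not> ?thesis"
  define P where "P A \<longleftrightarrow> A \<in> sets M \<and> \<not> compression_bounded A" for A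
  have "\<exists>A. \<forall>n. P (A n) \<and> (\<exists>B\<in>sets M. B \<subseteq> A n \<and> A (Suc n) = A n - B \<and>
    \<not> compression_bound B (2 ^ n * real n))"
  proof (rule dependent_nat_choice)
    show "\<exists>A. P A" using assms unfolding P_def by blast
    fix A n assume "P A"
    then obtain B where B: "B \<in> sets M" "B \<subseteq> A" "\<not> compression_bounded (A - B)"
        "\<not> compression_bound B (2 ^ n * real n)"
      using neg unfolding P_def by blast
    moreover have "P (A - B)" using B \<open>P A\<close> unfolding P_def by blast
    ultimately show "\<exists>A'. P A' \<and> (\<exists>B\<in>sets M. B \<subseteq> A \<and> A' = A - B \<and>
      \<not> compression_bound B (2 ^ n * real n))" by blast
  qed
  then obtain A where A: "\<forall>n. P (A n) \<and> (\<exists>B\<in>sets M. B \<subseteq> A n \<and> A (Suc n) = A n - B \<and>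
    \<not> compression_bound B (2 ^ n * real n))" by (elim exE)
  have "\<exists>B. B \<in> sets M \<and> B \<subseteq> A n \<and> A (Suc n) = A n - B \<and>
    \<not> compression_bound B (2 ^ n * real n)" for n
    using A[THEN spec, of n] by (elim conjE bexE) (intro exI conjI)
  then obtain B where B: "\<And>n. B n \<in> sets M" "\<And>n. B n \<subseteq> A n" "\<And>n. A (Suc n) = A n - B n"
    "\<And>n. \<not> compression_bound (B n) (2 ^ n * real n)" by metis
  have dec: "A m \<subseteq> A n" if "n \<le> m" for m n
    using that by (rule lift_Suc_antimono_le[of A, rotated]) (use B in auto)
  have disj: "B m \<inter> B n = {}" if "m < n" for m n
    using B(2)[of n] B(3)[of m] dec[of "Suc m" n] that by (auto simp: Suc_le_eq)
  show False
  proof (rule no_disjoint_unbounded_sequence[OF B(1) _ B(4)])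
    show "B m \<inter> B n = {}" if "m \<noteq> n" for m n
      using disj[of m n] disj[of n m] that by (auto simp: neq_iff)
  qed
qed

text \<open>Call a set bad if its compression is unbounded. In the set \<open>A\<close> found by
  \<open>exists_indecomposable\<close> the compressions of all subsets that are not bad share the bound \<open>N\<close>,
  so by the Fatou property these subsets form a \<open>\<sigma>\<close>-ideal. Removing one of maximal measure
  leaves an atom.\<close>

lemma exists_unbounded_atom:
  assumes "\<not> compression_bounded (space M)"
  shows "\<exists>E\<in>sets M. \<not> compression_bounded E \<and> emeasure M E < \<infinity> \<and>
    (\<forall>B\<in>sets M. B \<subseteq> E \<longrightarrow> B \<in> null_sets M \<or> E - B \<in> null_sets M)"
proof -
  obtain A N where A: "A \<in> sets M" "\<not> compression_bounded A"
    and tight: "\<And>B. B \<in> sets M \<Longrightarrow> B \<subseteq> A \<Longrightarrow> \<not> compression_bounded (A - B) \<Longrightarrow> compression_bound B N"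
    using exists_indecomposable[OF assms] by blast
  \<comment> \<open>If \<open>B\<close> and \<open>A - B\<close> both had bounded compressions, so
    would \<open>A\<close>; hence \<open>tight\<close> applies to \<open>B\<close>.\<close>
  have unif: "compression_bound B N" if "B \<in> sets M" "B \<subseteq> A" "compression_bounded B" for B
  proof (rule tight[OF that(1,2)])
    show "\<not> compression_bounded (A - B)"
    proof
      assume "compression_bounded (A - B)"
      then have "compression_bounded (B \<union> (A - B))"
        using that A by (intro compression_bounded_Un) auto
      then show False using A that by (simp add: Un_absorb1)
    qed
  qed
  obtain F :: "nat \<Rightarrow> 'w set" where F: "range F \<subseteq> sets M" "(\<Union>i. F i) = space M"
    "\<And>i. emeasure M (F i) \<noteq> \<infinity>" "incseq F"
    using sigma_finite_incseq by blast
  have Fn: "F n \<in> sets M" for n using F(1) by auto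
  \<comment> \<open>Reduction to finite measure: bounded compressions to all sets
    \<open>A \<inter> F n\<close> would share the bound \<open>N\<close> and thus pass to their
    union \<open>A\<close>.\<close>
  have "\<exists>n. \<not> compression_bounded (A \<inter> F n)"
  proof (rule ccontr)
    assume neg: "\<not> ?thesis"
    have "compression_bound (A \<inter> F n) N" for n
      using neg A Fn by (intro unif) auto
    then have "compression_bounded (\<Union>n. A \<inter> F n)"
      using A(1) Fn F(4) unfolding incseq_def
      by (intro compression_bounded_incseq) (fastforce simp: incseq_def)+
    moreover have "(\<Union>n. A \<inter> F n) = A" using F(2) sets.sets_into_space[OF A(1)] by auto
    ultimately show False using A(2) by simp
  qed
  then obtain n where n: "\<not> compression_bounded (A \<inter> F n)" by blast
  define G where "G = A \<inter> F n"
  have G: "G \<in> sets M" "\<not> compression_bounded G" "G \<subseteq> A" using n A Fn by (auto simp: G_def)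
  have "emeasure M G \<le> emeasure M (F n)" using Fn by (intro emeasure_mono) (auto simp: G_def)
  then have Gfin: "emeasure M G < \<infinity>" using F(3)[of n] by (auto simp: less_top[symmetric] top_unique)
  have fm: "B \<in> fmeasurable M" if "B \<in> sets M" "B \<subseteq> G" for B
    using fmeasurableI2[of G M B] G(1) Gfin that by (auto simp: fmeasurable_def)
  define \<B> where "\<B> = {B \<in> sets M. B \<subseteq> G \<and> compression_bounded B}"
  have Un\<B>: "B \<union> B' \<in> \<B>" if "B \<in> \<B>" "B' \<in> \<B>" for B B'
    using that compression_bounded_Un[of B B'] unfolding \<B>_def by auto
  have emp: "{} \<in> \<B>"
  proof -
    have "compression_bound {} 0" by (simp add: compression_bound_def band_proj_null)
    then show ?thesis by (auto simp: \<B>_def intro: compression_boundedI)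
  qed
  define m where "m = (SUP B\<in>\<B>. measure M B)"
  have bdd: "bdd_above (measure M ` \<B>)"
  proof (rule bdd_aboveI2)
    fix B assume "B \<in> \<B>"
    then have "B \<in> sets M" "B \<subseteq> G" by (simp_all add: \<B>_def)
    then show "measure M B \<le> measure M G"
      by (intro measure_mono_fmeasurable fm[OF G(1)] order_refl)
  qed
  have "\<exists>B\<in>\<B>. measure M B > m - 1 / real (Suc k)" for k
  proof -
    have "m - 1 / real (Suc k) < m" by simp
    then show ?thesis unfolding m_def using less_cSUP_iff[OF _ bdd] emp by blast
  qed
  then obtain B where B: "\<And>k. B k \<in> \<B>" "\<And>k. measure M (B k) > m - 1 / real (Suc k)" by metis
  \<comment> \<open>Finite unions turn the maximising sequence into an increasing one with common
    bound \<open>N\<close>, so that its union \<open>H\<close> stays in \<B> and attains the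
    supremum \<open>m\<close>.\<close>
  define D where "D k = (\<Union>i\<le>k. B i)" for k
  have D: "D k \<in> \<B>" for k
  proof (induction k)
    case 0
    then show ?case using B by (simp add: D_def)
  next
    case (Suc k)
    have "D (Suc k) = D k \<union> B (Suc k)" by (auto simp: D_def le_Suc_eq)
    then show ?case using Un\<B>[OF Suc B(1)] by simp
  qed
  have "compression_bounded (\<Union>k. D k)"
  proof (rule compression_bounded_incseq)
    show "range D \<subseteq> sets M" using D by (auto simp: \<B>_def)
    show "incseq D" unfolding incseq_def D_def by fastforce
    show "compression_bound (D k) N" for k using D[of k] G(3) by (intro unif) (auto simp: \<B>_def)
  qed
  then have UD: "(\<Union>k. D k) \<in> \<B>" using D unfolding \<B>_def by blast
  define H where "H = (\<Union>k. D k)"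
  have H: "H \<in> sets M" "H \<subseteq> G" "compression_bounded H" using UD by (auto simp: H_def \<B>_def)
  have "m \<le> measure M H"
  proof (rule field_le_epsilon)
    fix e :: real assume "e > 0"
    then obtain k where k: "inverse (real (Suc k)) < e" using reals_Archimedean by blast
    have "B k \<subseteq> H" by (auto simp: H_def D_def)
    then have "measure M (B k) \<le> measure M H"
      using B(1)[of k] by (intro measure_mono_fmeasurable fm H) (auto simp: \<B>_def)
    then show "m \<le> measure M H + e" using B(2)[of k] k by (simp add: inverse_eq_divide)
  qed
  \<comment> \<open>Adjoining \<open>B'\<close> to \<open>H\<close> stays in \<B>, so by maximality
    it cannot increase the measure.\<close>
  have null: "B' \<in> null_sets M" if B': "B' \<in> sets M" "B' \<subseteq> G - H" "compression_bounded B'" for B'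
  proof -
    have "B' \<in> \<B>" using B' by (auto simp: \<B>_def)
    then have "measure M (H \<union> B') \<le> m"
      unfolding m_def using UD by (intro cSUP_upper bdd Un\<B>) (auto simp: H_def)
    moreover have "measure M (H \<union> B') = measure M H + measure M B'"
    proof (rule measure_Union)
      show "emeasure M H \<noteq> \<infinity>" "emeasure M B' \<noteq> \<infinity>"
        using fm[OF H(1,2)] fm[of B'] B' by (auto simp: fmeasurable_def less_top)
    qed (use B' H in auto)
    ultimately have "measure M B' = 0"
      using \<open>m \<le> measure M H\<close> measure_nonneg[of M B'] by linarith
    moreover have "B' \<in> fmeasurable M" using B' by (intro fm) auto
    ultimately show ?thesis
      by (auto simp: null_sets_def fmeasurable_def emeasure_eq_ennreal_measure less_top)
  qed
  have "\<not> compression_bounded (G - H)"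
  proof
    assume "compression_bounded (G - H)"
    then have "compression_bounded (H \<union> (G - H))"
      using H G by (intro compression_bounded_Un) auto
    then show False using G H by (simp add: Un_absorb1)
  qed
  moreover have "B' \<in> null_sets M \<or> (G - H) - B' \<in> null_sets M"
    if B': "B' \<in> sets M" "B' \<subseteq> G - H" for B'
  proof (cases "compression_bounded B'")
    case True
    then show ?thesis using null B' by blast
  next
    case False
    \<comment> \<open>This complement contains \<open>B'\<close>, whose compression is unbounded;
      \<open>tight\<close> therefore bounds the compression to \<open>(G - H) - B'\<close>, which
      makes that set null.\<close>
    have "\<not> compression_bounded (A - ((G - H) - B'))"
    proof
      assume "compression_bounded (A - ((G - H) - B'))"
      then have "compression_bounded B'"
        using A G H B' compression_bound_subset[of "A - ((G - H) - B')" B']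
        unfolding compression_bounded_def by blast
      then show False using False by simp
    qed
    then have "compression_bound ((G - H) - B') N" using A G H B' by (intro tight) auto
    then show ?thesis using G H B' by (intro disjI2 null) (auto intro: compression_boundedI)
  qed
  moreover have "G - H \<in> sets M" "emeasure M (G - H) < \<infinity>"
    using fm[of "G - H"] G H by (auto simp: fmeasurable_def)
  ultimately show ?thesis by blast
qed

section \<open>Boundedness on atoms and of \<open>S\<close>\<close>

text \<open>Over an atom of positive measure the projection has rank one: its range is spanned by
  the class \<open>e\<close> of the indicator, so the single vector \<open>S e\<close> determines
  the bound.\<close>

lemma compression_bounded_atom:
  assumes E: "E \<in> sets M" "emeasure M E < \<infinity>"
    and atom: "\<And>B. B \<in> sets M \<Longrightarrow> B \<subseteq> E \<Longrightarrow> B \<in> null_sets M \<or> E - B \<in> null_sets M"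
  shows "compression_bounded E"
proof (cases "emeasure M E = 0")
  case True
  then have "E \<in> null_sets M" using E by auto
  then have "compression_bound E 0"
    by (simp add: compression_bound_def band_proj_null)
  then show ?thesis by (rule compression_boundedI)
next
  case False
  then have pos: "0 < emeasure M E" by (simp add: zero_less_iff_neq_zero)
  obtain e where e: "AE w in M. rep e w = indicator E w" using rep_indicator[OF E(1) pos E(2)] by blast
  have "e \<noteq> 0"
  proof
    assume "e = 0"
    then have "AE w in M. w \<notin> E" using e rep_zero by (auto elim!: eventually_elim2 simp: indicator_def)
    then show False using False AE_iff_null_sets[OF E(1)] by auto
  qed
  then have ne: "norm e > 0" by simp
  have "norm (band_proj E (S (band_proj E x))) \<le> norm (S e) / norm e * norm x" for x
  proof -
    obtain c where c: "AE w in M. indicator E w * rep x w = c * indicator E w"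
      using rep_constant_on_atom[OF E(1) pos E(2) atom, of x] by blast
    have "AE w in M. rep (c *\<^sub>R e) w = indicator E w * rep x w"
      using c e rep_scaleR[of c e] by eventually_elim (simp only:)
    then have ce: "band_proj E x = c *\<^sub>R e" by (rule band_proj_eqI[OF E(1)])
    have "norm (band_proj E (S (band_proj E x))) \<le> norm (S (band_proj E x))"
      by (rule norm_band_proj_le[OF E(1)])
    also have "\<dots> = norm (S e) / norm e * norm (band_proj E x)"
      using ne by (simp add: ce linear_scale[OF linear_S])
    also have "\<dots> \<le> norm (S e) / norm e * norm x"
      by (intro mult_left_mono norm_band_proj_le E) simp
    finally show ?thesis .
  qed
  then have "compression_bound E (norm (S e) / norm e)" by (simp add: compression_bound_def)
  then show ?thesis by (rule compression_boundedI)
qed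

text \<open>The projection to \<open>space M\<close> is the identity, so \<open>S\<close> is its own
  compression there.\<close>

lemma bounded: "\<exists>C. \<forall>x. norm (S x) \<le> C * norm x"
proof -
  have "compression_bounded (space M)"
    using exists_unbounded_atom compression_bounded_atom by blast
  then show ?thesis by (auto simp: compression_bounded_def compression_bound_def band_proj_space)
qed

end

section \<open>Isolated points\<close>

lemma eps_band_preserving_bounded_at_isolated_point:
  fixes M :: "'w measure" and rep :: "'x :: banach_lattice \<Rightarrow> 'w \<Rightarrow> real"
    and T :: "('k :: t2_space, 'x) c0 \<Rightarrow> ('k, 'x) c0"
  assumes koethe: "koethe_function_space M rep" and fatou: "fatou_norm TYPE('x)"
    and K: "locally_compact_space (euclidean :: 'k topology)"
    and \<epsilon>: "0 \<le> \<epsilon>" and lin: "linear T" and T: "eps_band_preserving \<epsilon> T"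
    and t: "open {t}"
  shows "\<exists>C. \<forall>f. norm (apply_c0 (T f) t) \<le> C * norm f"
proof -
  interpret koethe_function_space M rep by (rule koethe)
  \<comment> \<open>Since \<open>{t}\<close> is open and compact, a value prescribed at
    \<open>t\<close> and extended by 0 is continuous and vanishes at infinity.\<close>
  define \<delta> :: "'x \<Rightarrow> ('k, 'x) c0" where "\<delta> x = Abs_c0 (\<lambda>s. if s = t then x else 0)" for x
  have \<delta>: "apply_c0 (\<delta> x) s = (if s = t then x else 0)" for x s
  proof -
    have "continuous_on ({t} \<union> - {t}) (\<lambda>s. if s = t then x else 0)"
      using t by (intro continuous_on_cases) auto
    then have "continuous_on UNIV (\<lambda>s. if s = t then x else 0)" by simp
    moreover have "vanishes_at_infinity (\<lambda>s. if s = t then x else 0)"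
      unfolding vanishes_at_infinity_def by (intro allI impI exI[of _ "{t}"]) auto
    ultimately show ?thesis by (simp add: \<delta>_def Abs_c0_inverse)
  qed
  have norm_\<delta>: "norm (\<delta> x) \<le> norm x" for x by (rule norm_c0_le) (simp add: \<delta>)
  have lin_\<delta>: "linear \<delta>"
    by (rule linearI; rule c0_eqI) (simp_all add: \<delta> plus_c0.rep_eq scaleR_c0.rep_eq)
  define S where "S x = apply_c0 (T (\<delta> x)) t" for x
  interpret almost_local_operator M rep S \<epsilon>
  proof (intro almost_local_operator.intro almost_local_operator_axioms.intro koethe \<epsilon> fatou)
    show "linear S"
      using linear_compose[OF linear_compose[OF lin_\<delta> lin]
          bounded_linear.linear[OF bounded_linear_apply_c0[of t]]]
      by (simp add: S_def[abs_def] o_def)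
    show "norm (band_proj A (S (band_proj (space M - A) x))) \<le> \<epsilon> * norm x" if A: "A \<in> sets M" for A x
    proof -
      define u where "u = band_proj (space M - A) x"
      \<comment> \<open>The test element lies over \<open>A\<close>, hence is disjoint from
        \<open>u\<close>, and below \<open>\<bar>S u\<bar>\<close>, so the infimum with it returns
        \<open>y\<close>.\<close>
      define y where "y = band_proj A \<bar>S u\<bar>"
      have y: "0 \<le> y" "y \<le> \<bar>S u\<bar>" "norm y = norm (band_proj A (S u))"
        by (simp_all add: y_def band_proj_abs[OF A] norm_abs_lattice band_proj_abs_le[OF A, unfolded band_proj_abs[OF A]])
      have "0 \<le> \<delta> y" using y by (simp add: less_eq_c0.rep_eq zero_c0.rep_eq \<delta>)
      moreover have "disjoint_elems y u" unfolding y_def u_def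
        using A by (intro disjoint_band_proj) auto
      then have "disjoint_elems (\<delta> y) (\<delta> u)"
        unfolding disjoint_elems_def
        by (intro c0_eqI) (simp add: inf_c0.rep_eq apply_c0_abs zero_c0.rep_eq \<delta>)
      ultimately have "norm (inf \<bar>T (\<delta> u)\<bar> (\<delta> y)) \<le> \<epsilon> * norm (\<delta> u)" by (rule eps_band_preservingD[OF T])
      moreover have "apply_c0 (inf \<bar>T (\<delta> u)\<bar> (\<delta> y)) t = y"
        using y(2) by (simp add: inf_c0.rep_eq apply_c0_abs \<delta> S_def inf_absorb2)
      then have "norm y \<le> norm (inf \<bar>T (\<delta> u)\<bar> (\<delta> y))"
        using norm_apply_c0_le[of "inf \<bar>T (\<delta> u)\<bar> (\<delta> y)" t] by simp
      moreover have "norm (\<delta> u) \<le> norm x"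
        unfolding u_def using A by (intro order_trans[OF norm_\<delta>] norm_band_proj_le) auto
      then have "\<epsilon> * norm (\<delta> u) \<le> \<epsilon> * norm x" by (rule mult_left_mono[OF _ \<epsilon>])
      ultimately show ?thesis using y(3) unfolding u_def by linarith
    qed
  qed
  obtain C where C: "\<And>x. norm (S x) \<le> C * norm x" using bounded by blast
  \<comment> \<open>The difference of \<open>f\<close> and \<open>\<delta> (apply_c0 f t)\<close>
    vanishes on the open set \<open>{t}\<close> and has norm at most \<open>2 * norm f\<close>;
    locality turns it into the error \<open>2 * \<epsilon>\<close>.\<close>
  have "norm (apply_c0 (T f) t) \<le> (\<bar>C\<bar> + 2 * \<epsilon>) * norm f" for f
  proof -
    let ?x = "apply_c0 f t"
    have x: "norm ?x \<le> norm f" by (rule norm_apply_c0_le)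
    have "norm (apply_c0 (T (f - \<delta> ?x)) t) \<le> \<epsilon> * norm (f - \<delta> ?x)"
      by (rule eps_band_preserving_local[OF K T t]) (auto simp: minus_c0.rep_eq \<delta>)
    also have "\<dots> \<le> \<epsilon> * (2 * norm f)"
      using norm_triangle_ineq4[of f "\<delta> ?x"] norm_\<delta>[of ?x] x by (intro mult_left_mono \<epsilon>) linarith
    finally have "norm (apply_c0 (T f) t - S ?x) \<le> \<epsilon> * (2 * norm f)"
      by (simp add: linear_diff[OF lin] minus_c0.rep_eq S_def)
    moreover have "norm (S ?x) \<le> \<bar>C\<bar> * norm f"
      by (rule order_trans[OF C]) (intro mult_mono x, auto)
    ultimately show ?thesis
      using norm_triangle_sub[of "apply_c0 (T f) t" "S ?x"] by (simp add: algebra_simps)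
  qed
  then show ?thesis by blast
qed

section \<open>From point evaluations to continuity of \<open>T\<close>\<close>

theorem theorem3p7:
  fixes M :: "'w measure"
    and rep :: "'x :: banach_lattice \<Rightarrow> 'w \<Rightarrow> real"
    and T :: "('k :: t2_space, 'x) c0 \<Rightarrow> ('k, 'x) c0"
    and \<epsilon> :: real
  assumes "koethe_function_space M rep"
    and "fatou_norm TYPE('x)"
    and "locally_compact_space (euclidean :: 'k topology)"
    and "0 \<le> \<epsilon>"
    and "linear T"
    and "eps_band_preserving \<epsilon> T"
  shows "continuous_on UNIV T"
proof -
  have "bounded_linear (\<lambda>f. apply_c0 (T f) t)" for t
  proof -
    have "\<exists>C. \<forall>f. norm (apply_c0 (T f) t) \<le> C * norm f"
      using eps_band_preserving_bounded_at_isolated_point[OF assms, of t]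
        eps_band_preserving_bounded_at_limit_point[OF assms(3-6), of t] by blast
    then obtain C where "\<And>f. norm (apply_c0 (T f) t) \<le> C * norm f" by blast
    then show ?thesis
      by (intro bounded_linear_intro[where K = C])
        (simp_all add: linear_add[OF assms(5)] linear_scale[OF assms(5)] plus_c0.rep_eq
          scaleR_c0.rep_eq mult.commute)
  qed
  \<comment> \<open>For fixed \<open>f\<close> the number \<open>norm (T f)\<close> bounds all
    evaluations, which is the pointwise hypothesis of uniform boundedness.\<close>
  moreover have "\<exists>B. \<forall>t. norm (apply_c0 (T f) t) \<le> B" for f
    using norm_apply_c0_le by blast
  ultimately obtain C where "\<And>t f. norm (apply_c0 (T f) t) \<le> C * norm f"
    using uniform_boundedness_principle[of "\<lambda>t f. apply_c0 (T f) t"] by blast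
  then have "norm (T f) \<le> C * norm f" for f by (rule norm_c0_le)
  then have "bounded_linear T"
    by (intro bounded_linear_intro[where K = C])
      (simp_all add: linear_add[OF assms(5)] linear_scale[OF assms(5)] mult.commute)
  then show ?thesis by (rule linear_continuous_on)
qed

end
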